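(* Let $L,\mathfrak d\in\mathbb N$, $(\ell_k)_{k\in\mathbb N_0}\subseteq\mathbb N$, $a\in\mathbb R$, $b\in(a,\infty)$, $\xi\in\mathbb R^{\ell_L}$ satisfy $\mathfrak d=\sum_{k=1}^L\ell_k(\ell_{k-1}+1)$. For every $\theta=(\theta_1,\dots,\theta_{\mathfrak d})\in\mathbb R^{\mathfrak d}$, $k\in\{1,\dots,L\}$, $i\in\{1,\dots,\ell_k\}$, $j\in\{1,\dots,\ell_{k-1}\}$ let $\mathfrak w^{k,\theta}_{i,j}=\theta_{(i-1)\ell_{k-1}+j+\sum_{h=1}^{k-1}\ell_h(\ell_{h-1}+1)}$ and $\mathfrak b^{k,\theta}_i=\theta_{\ell_k\ell_{k-1}+i+\sum_{h=1}^{k-1}\ell_h(\ell_{h-1}+1)}$, let $\mathfrak w^{k,\theta}=(\mathfrak w^{k,\theta}_{i,j})_{(i,j)\in\{1,\dots,\ell_k\}\times\{1,\dots,\ell_{k-1}\}}\in\mathbb R^{\ell_k\times\ell_{k-1}}$, $\mathfrak b^{k,\theta}=(\mathfrak b^{k,\theta}_1,\dots,\mathfrak b^{k,\theta}_{\ell_k})\in\mathbb R^{\ell_k}$, and let $\mathcal A^\theta_k\colon\mathbb R^{\ell_{k-1}}\to\mathbb R^{\ell_k}$, $\mathcal A^\theta_k(x)=\mathfrak b^{k,\theta}+\mathfrak w^{k,\theta}x$. Let $\mathscr R_r\colon\mathbb R\to\mathbb R$, $r\in[1,\infty]$, satisfy $\mathscr R_\infty(y)=\max\{y,0\}$ for all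 $y\in\mathbb R$ and, for all $r\in[1,\infty)$, $x\in(-\infty,2^{-1}r^{-1}]$, $y\in\mathbb R$, $z\in[r^{-1},\infty)$: $\mathscr R_r\in C^1(\mathbb R,\mathbb R)$, $\mathscr R_r(x)=0$, $0\le\mathscr R_r(y)\le\max\{y,0\}$, and $\mathscr R_r(z)=z$; assume $\sup_{r\in[1,\infty)}\sup_{x\in\mathbb R}|(\mathscr R_r)'(x)|<\infty$. Let $\|\cdot\|$ denote the Euclidean norm on each $\mathbb R^n$ and, for $r\in[1,\infty]$, let $\mathfrak M_r(x_1,\dots,x_n)=(\mathscr R_r(x_1),\dots,\mathscr R_r(x_n))$. Let $(\Omega,\mathcal F,\mathbb P)$ be a probability space, let $X^{n,m}\colon\Omega\to[a,b]^{\ell_0}$, $n,m\in\mathbb N_0$, be i.i.d. random variables, and let $(M_n)_{n\in\mathbb N_0}\subseteq\mathbb N$. For $r\in[1,\infty]$ and $\theta\in\mathbb R^{\mathfrak d}$ define $\mathcal N^{k,\theta}_r\colon\mathbb R^{\ell_0}\to\mathbb R^{\ell_k}$, $k\in\{1,\dots,L\}$, by $\mathcal N^{1,\theta}_r=\mathcal A^\theta_1$ and $\mathcal N^{k+1,\theta}_r(x)=\mathcal A^\theta_{k+1}(\mathfrak M_{r^{1/k}}(\mathcal N^{k,\theta}_r(x)))$ (with $\infty^{1/k}=\infty$), and define $\mathfrak L^n_r\colon\mathbb R^{\mathfrak d}\times\Omega\to\mathbb R$, $n\in\mathbb N_0$, by $\mathfrak L^n_r(\theta,\omega)=\frac1{M_n}\sum_{m=1}^{M_n}\|\mathcal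 N^{L,\theta}_r(X^{n,m}(\omega))-\xi\|^2$. Let $\mathcal L\colon\mathbb R^{\mathfrak d}\to\mathbb R$, $\mathcal L(\theta)=\mathbb E[\|\mathcal N^{L,\theta}_\infty(X^{0,0})-\xi\|^2]$. For every $n\in\mathbb N_0$ let $\mathfrak G^n\colon\mathbb R^{\mathfrak d}\times\Omega\to\mathbb R^{\mathfrak d}$ satisfy $\mathfrak G^n(\theta,\omega)=\lim_{r\to\infty}(\nabla_\theta\mathfrak L^n_r)(\theta,\omega)$ for all $\theta\in\mathbb R^{\mathfrak d}$ and all $\omega$ for which $((\nabla_\theta\mathfrak L^n_r)(\theta,\omega))_{r\in[1,\infty)}$ is convergent as $r\to\infty$. Let $\Theta=(\Theta_n)_{n\in\mathbb N_0}\colon\mathbb N_0\times\Omega\to\mathbb R^{\mathfrak d}$ be a stochastic process and $(\gamma_n)_{n\in\mathbb N_0}\subseteq[0,\infty)$, assume that $\Theta_0$ and $(X^{n,m})_{(n,m)\in\mathbb N_0^2}$ are independent, and assume for all $n\in\mathbb N_0$, $\omega\in\Omega$ that $\Theta_{n+1}(\omega)=\Theta_n(\omega)-\gamma_n\mathfrak G^n(\Theta_n(\omega),\omega)$, that $(4L\mathfrak d\max\{|a|,|b|,\|\xi\|,1\})^{2L}\gamma_n\le(\|\Theta_0(\omega)\|+1)^{-2L}$, and that $\sum_{k=0}^\infty\gamma_k=\infty$. Then (i) there exists $\mathfrak C\in\mathbb R$ such that $\mathbb P(\sup_{n\in\mathbb N_0}\|\Theta_n\|\le\mathfrak C)=1$,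 (ii) $\mathbb P(\limsup_{n\to\infty}\mathcal L(\Theta_n)=0)=1$, and (iii) $\limsup_{n\to\infty}\mathbb E[\mathcal L(\Theta_n)]=0$.
   Context: $\mathbb N=\{1,2,3,\dots\}$, $\mathbb N_0=\mathbb N\cup\{0\}$. $\nabla_\theta$ denotes the gradient with respect to $\theta\in\mathbb R^{\mathfrak d}$. The vector $\xi$ represents the constant target function $[a,b]^{\ell_0}\ni x\mapsto\xi$. *)

theory Defs
  imports "HOL-Analysis.Analysis" "HOL-Probability.Probability"
begin

text \<open>Vectors in R^n with varying n are represented as functions nat => real,
  only the components 1..n being relevant.\<close>

definition vnorm :: "nat \<Rightarrow> (nat \<Rightarrow> real) \<Rightarrow> real" where
  "vnorm n v = sqrt (\<Sum>i=1..n. (v i)^2)"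

definition offs :: "(nat \<Rightarrow> nat) \<Rightarrow> nat \<Rightarrow> nat" where
  "offs l k = (\<Sum>h=1..k-1. l h * (l (h-1) + 1))"

definition wgt :: "(nat \<Rightarrow> nat) \<Rightarrow> (nat \<Rightarrow> real) \<Rightarrow> nat \<Rightarrow> nat \<Rightarrow> nat \<Rightarrow> real" where
  "wgt l \<theta> k i j = \<theta> ((i-1) * l (k-1) + j + offs l k)"

definition bias :: "(nat \<Rightarrow> nat) \<Rightarrow> (nat \<Rightarrow> real) \<Rightarrow> nat \<Rightarrow> nat \<Rightarrow> real" where
  "bias l \<theta> k i = \<theta> (l k * l (k-1) + i + offs l k)"

definition affine :: "(nat \<Rightarrow> nat) \<Rightarrow> (nat \<Rightarrow> real) \<Rightarrow> nat \<Rightarrow> (nat \<Rightarrow> real) \<Rightarrow> (nat \<Rightarrow> real)" where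
  "affine l \<theta> k x = (\<lambda>i. bias l \<theta> k i + (\<Sum>j=1..l (k-1). wgt l \<theta> k i j * x j))"

text \<open>Realization N^{k,theta}: act k is the activation applied after layer k
  (componentwise). The case k = 0 is unused.\<close>
fun realiz :: "(nat \<Rightarrow> nat) \<Rightarrow> (nat \<Rightarrow> real \<Rightarrow> real) \<Rightarrow> (nat \<Rightarrow> real) \<Rightarrow> nat
     \<Rightarrow> (nat \<Rightarrow> real) \<Rightarrow> (nat \<Rightarrow> real)" where
  "realiz l act \<theta> 0 x = x"
| "realiz l act \<theta> (Suc 0) x = affine l \<theta> 1 x"
| "realiz l act \<theta> (Suc (Suc k)) x =
     affine l \<theta> (Suc (Suc k)) (\<lambda>i. act (Suc k) (realiz l act \<theta> (Suc k) x i))"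

definition grad :: "('a::real_inner \<Rightarrow> real) \<Rightarrow> 'a \<Rightarrow> 'a" where
  "grad f x = (THE D. GDERIV f x :> D)"

end

theory Submission
  imports Defs
begin

text \<open>Since the smoothing in layer \<open>k\<close> is on the scale \<open>r powr (- 1 / k)\<close>, the gradients of the smoothed empirical
  risks converge everywhere, so \<open>G\<close> is the explicit generalized gradient in which the derivative of
  the ReLU is the indicator function of the positive reals.

  Let \<open>V\<close> be the squared distance of the parameters from the network with last bias \<open>\<xi>\<close> and all other
  parameters 0, the biases of layer \<open>k\<close> being weighted by \<open>k\<close>. By quasi-homogeneity of the ReLU
  network, the inner product of \<open>G\<close> with the gradient of \<open>V\<close> is \<open>4 L\<close> times the empirical risk, whereas
  the squared norm of \<open>G\<close> is at most a constant times the empirical risk on sublevel sets of \<open>V\<close>. Under the step size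
  restriction, \<open>V\<close> therefore decreases along every trajectory by at least \<open>2 L \<gamma>\<close> times the empirical
  risk, which yields boundedness and the summability of \<open>\<gamma>\<close> times the empirical risk.

  As \<open>\<Theta> n\<close> is independent of the batch \<open>n\<close>, the empirical risk may be replaced by the true risk in
  expectation, hence \<open>\<gamma> n * risk (\<Theta> n)\<close> is almost surely summable. The increments of the risk are bounded by a
  multiple of \<open>\<gamma> n\<close> and square summable, which together with the divergence of the sum of the \<open>\<gamma> n\<close> forces
  convergence to 0; dominated convergence gives the statement on expectations.\<close>

section \<open>Layered parameters and norm bounds\<close>

text \<open>The flat index runs through the layers in order; inside a layer the weight matrix comes
  first, row by row, and then the biases. Flat sums thereby become sums over weights and
  biases.\<close>

lemma sum_params:
  fixes f :: "nat \<Rightarrow> real"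
  shows "(\<Sum>q=1..offs l (Suc L). f q) = (\<Sum>k=1..L. \<Sum>i=1..l k.
    f (l k * l (k-1) + i + offs l k) + (\<Sum>j=1..l (k-1). f ((i-1) * l (k-1) + j + offs l k)))"
proof (induction L)
  case 0
  show ?case by (simp add: offs_def)
next
  case (Suc L)
  \<comment> \<open>Row-major enumeration of an m by n matrix.\<close>
  have blocks: "(\<Sum>q=1..m*n. g q) = (\<Sum>i=1..m. \<Sum>j=1..n. g ((i-1)*n+j))"
    for g :: "nat \<Rightarrow> real" and m n
  proof (induction m)
    case (Suc m)
    have "(\<Sum>q=1..Suc m*n. g q) = (\<Sum>q=1..m*n. g q) + (\<Sum>q=m*n+1..m*n+n. g q)"
      using sum.ub_add_nat[of 1 "m*n" g n] by (simp add: add.commute)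
    also have "(\<Sum>q=m*n+1..m*n+n. g q) = (\<Sum>j=1..n. g (m*n+j))"
      using sum.shift_bounds_cl_nat_ivl[of g 1 "m*n" n] by (simp add: add.commute)
    finally show ?case using Suc by simp
  qed simp
  let ?o = "offs l (Suc L)" and ?w = "l (Suc L) * l L"
  have o: "offs l (Suc (Suc L)) = ?o + (?w + l (Suc L))"
    by (simp add: offs_def)
  have "(\<Sum>q=1..offs l (Suc (Suc L)). f q) = (\<Sum>q=1..?o. f q) + (\<Sum>q=?o+1..?o+(?w + l (Suc L)). f q)"
    unfolding o using sum.ub_add_nat[of 1 ?o f] by simp
  also have "(\<Sum>q=?o+1..?o+(?w + l (Suc L)). f q) = (\<Sum>q=1..?w + l (Suc L). f (q + ?o))"
    using sum.shift_bounds_cl_nat_ivl[of f 1 ?o "?w + l (Suc L)"] by (simp add: add.commute)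
  also have "\<dots> = (\<Sum>q=1..?w. f (q + ?o)) + (\<Sum>q=?w+1..?w+l (Suc L). f (q + ?o))"
    by (rule sum.ub_add_nat) simp
  also have "(\<Sum>q=?w+1..?w+l (Suc L). f (q + ?o)) = (\<Sum>i=1..l (Suc L). f (?w + i + ?o))"
    using sum.shift_bounds_cl_nat_ivl[of "\<lambda>q. f (q + ?o)" 1 ?w "l (Suc L)"] by (simp add: add_ac)
  also have "(\<Sum>q=1..?w. f (q + ?o)) = (\<Sum>i=1..l (Suc L). \<Sum>j=1..l L. f ((i-1)*l L + j + ?o))"
    by (rule blocks)
  finally show ?case using Suc by (simp add: sum.distrib)
qed

text \<open>The squared Frobenius norm of layer \<open>k\<close>, biases included; its square root
  bounds the operator norm of the linear part of the layer.\<close>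

definition lay :: "(nat \<Rightarrow> nat) \<Rightarrow> nat \<Rightarrow> (nat \<Rightarrow> real) \<Rightarrow> real" where
  "lay l k \<theta> = (\<Sum>i=1..l k. (bias l \<theta> k i)\<^sup>2 + (\<Sum>j=1..l (k-1). (wgt l \<theta> k i j)\<^sup>2))"

lemma offs_eq_card: "(\<Sum>k=1..L. l k * (l (k-1) + 1)) = offs l (Suc L)"
  by (simp add: offs_def)

lemma inner_sum_params:
  fixes p q :: "real^'d::finite"
  assumes e: "bij_betw e {1..n} (UNIV :: 'd set)"
  shows "p \<bullet> q = (\<Sum>j=1..n. p $ e j * q $ e j)"
  unfolding inner_vec_def inner_real_def
  using sum.reindex_bij_betw[OF e, of "\<lambda>i. p $ i * q $ i"] by simp

lemma norm_sq_eq_lay: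
  fixes p :: "real^'d::finite"
  assumes e: "bij_betw e {1..offs l (Suc L)} (UNIV :: 'd set)"
  shows "(norm p)\<^sup>2 = (\<Sum>k=1..L. lay l k (\<lambda>j. p $ e j))"
  unfolding power2_norm_eq_inner inner_sum_params[OF e] sum_params
  by (simp add: lay_def bias_def wgt_def power2_eq_square)

lemma lay_nonneg: "0 \<le> lay l k \<theta>"
  unfolding lay_def by (intro sum_nonneg add_nonneg_nonneg) auto

lemma lay_le_norm_sq:
  fixes p :: "real^'d::finite"
  assumes e: "bij_betw e {1..offs l (Suc L)} (UNIV :: 'd set)" and "1 \<le> k" "k \<le> L"
  shows "lay l k (\<lambda>j. p $ e j) \<le> (norm p)\<^sup>2"
  unfolding norm_sq_eq_lay[OF e]
  by (rule member_le_sum) (use assms lay_nonneg in auto)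

lemma vnorm_eq_L2_set: "vnorm n v = L2_set v {1..n}"
  by (simp add: vnorm_def L2_set_def)

lemma vnorm_sq: "(vnorm n v)\<^sup>2 = (\<Sum>i=1..n. (v i)\<^sup>2)"
  by (simp add: vnorm_def sum_nonneg)

lemma vnorm_nonneg: "0 \<le> vnorm n v"
  by (simp add: vnorm_eq_L2_set)

lemma vnorm_mono: "(\<And>i. \<lbrakk>1 \<le> i; i \<le> n\<rbrakk> \<Longrightarrow> \<bar>v i\<bar> \<le> \<bar>w i\<bar>) \<Longrightarrow> vnorm n v \<le> vnorm n w"
  unfolding vnorm_def by (intro real_sqrt_le_mono sum_mono) (auto simp: abs_le_square_iff)

definition lin :: "(nat \<Rightarrow> nat) \<Rightarrow> (nat \<Rightarrow> real) \<Rightarrow> nat \<Rightarrow> (nat \<Rightarrow> real) \<Rightarrow> (nat \<Rightarrow> real)" where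
  "lin l \<theta> k v = (\<lambda>i. \<Sum>j=1..l (k-1). wgt l \<theta> k i j * v j)"

lemma vnorm_lin_le: "vnorm (l k) (lin l \<theta> k v) \<le> sqrt (lay l k \<theta>) * vnorm (l (k-1)) v"
proof -
  have "(\<Sum>i=1..l k. (lin l \<theta> k v i)\<^sup>2) \<le> (\<Sum>i=1..l k. (\<Sum>j=1..l (k-1). (wgt l \<theta> k i j)\<^sup>2) * (vnorm (l (k-1)) v)\<^sup>2)"
    unfolding lin_def vnorm_sq by (intro sum_mono Cauchy_Schwarz_ineq_sum)
  also have "\<dots> \<le> lay l k \<theta> * (vnorm (l (k-1)) v)\<^sup>2"
    unfolding lay_def sum_distrib_right[symmetric] by (intro mult_right_mono sum_mono) auto
  finally have "vnorm (l k) (lin l \<theta> k v) \<le> sqrt (lay l k \<theta> * (vnorm (l (k-1)) v)\<^sup>2)"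
    unfolding vnorm_def[of "l k"] by (rule real_sqrt_le_mono)
  then show ?thesis by (simp add: real_sqrt_mult vnorm_nonneg)
qed

text \<open>The bias acts as a weight on an extra input 1, so Cauchy-Schwarz in each row produces
  the factor 1 + |v|^2.\<close>

lemma vnorm_affine_le:
  "vnorm (l k) (affine l \<theta> k v) \<le> sqrt (lay l k \<theta>) * sqrt (1 + (vnorm (l (k-1)) v)\<^sup>2)"
proof -
  have cs: "(b + (\<Sum>j=1..m. w j * v j))\<^sup>2 \<le> (b\<^sup>2 + (\<Sum>j=1..m. (w j)\<^sup>2)) * (1 + (\<Sum>j=1..m. (v j)\<^sup>2))"
    for b :: real and w and m :: nat
    \<comment> \<open>Slot 0 of the two vectors holds the bias and the constant input 1.\<close>
    using Cauchy_Schwarz_ineq_sum[of "w(0:=b)" "v(0:=1)" "{0..m}"]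
    by (simp add: sum.atLeast_Suc_atMost cong: sum.cong_simp)
  have "(\<Sum>i=1..l k. (affine l \<theta> k v i)\<^sup>2) \<le> lay l k \<theta> * (1 + (vnorm (l (k-1)) v)\<^sup>2)"
    unfolding affine_def vnorm_sq lay_def sum_distrib_right by (intro sum_mono cs)
  from real_sqrt_le_mono[OF this] show ?thesis
    by (simp add: real_sqrt_mult vnorm_def[of "l k"])
qed

lemma vnorm_triangle: "vnorm n (\<lambda>i. v i + w i) \<le> vnorm n v + vnorm n w"
  unfolding vnorm_eq_L2_set by (rule L2_set_triangle_ineq)

text \<open>At \<open>k = 0\<close> this is the input itself, so that \<open>realiz_Suc\<close>
  treats the first layer like all others.\<close>

definition hid :: "(nat \<Rightarrow> nat) \<Rightarrow> (nat \<Rightarrow> real \<Rightarrow> real) \<Rightarrow> (nat \<Rightarrow> real) \<Rightarrow> nat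
     \<Rightarrow> (nat \<Rightarrow> real) \<Rightarrow> (nat \<Rightarrow> real)" where
  "hid l act \<theta> k x = (\<lambda>i. if k = 0 then x i else act k (realiz l act \<theta> k x i))"

lemma realiz_Suc: "realiz l act \<theta> (Suc k) x = affine l \<theta> (Suc k) (hid l act \<theta> k x)"
  by (cases k) (auto simp: hid_def)

text \<open>Forward-mode derivative of the realization at \<open>\<theta>\<close> in direction \<open>\<eta>\<close>, where \<open>act'\<close>
  stands for the derivative of \<open>act\<close>; with \<open>relu\<close> and \<open>heaviside\<close> it is the generalized derivative.\<close>
primrec drealiz :: "(nat \<Rightarrow> nat) \<Rightarrow> (nat \<Rightarrow> real \<Rightarrow> real) \<Rightarrow> (nat \<Rightarrow> real \<Rightarrow> real)
    \<Rightarrow> (nat \<Rightarrow> real) \<Rightarrow> (nat \<Rightarrow> real) \<Rightarrow> nat \<Rightarrow> (nat \<Rightarrow> real) \<Rightarrow> (nat \<Rightarrow> real)" where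
  "drealiz l act act' \<theta> \<eta> 0 x = (\<lambda>i. 0)"
| "drealiz l act act' \<theta> \<eta> (Suc k) x = (\<lambda>i. affine l \<eta> (Suc k) (hid l act \<theta> k x) i
     + lin l \<theta> (Suc k) (\<lambda>j. act' k (realiz l act \<theta> k x j) * drealiz l act act' \<theta> \<eta> k x j) i)"

definition relu :: "nat \<Rightarrow> real \<Rightarrow> real" where "relu k y = max y 0"

definition heaviside :: "nat \<Rightarrow> real \<Rightarrow> real" where "heaviside k y = (if 0 < y then 1 else 0)"

lemma relu_fold: "(\<lambda>k y. max y 0) = relu"
  by (auto simp: relu_def fun_eq_iff)

text \<open>Keeping the 1 under the root makes the bound multiplicative: \<open>relu\<close> does
  not increase absolute values, and \<open>1 + T * u \<le> (1 + T) * u\<close> for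
  \<open>u \<ge> 1\<close>, so each layer costs one factor \<open>sqrt (1 + T)\<close>.\<close>

lemma hid_bound:
  assumes "\<And>k. \<lbrakk>1 \<le> k; k \<le> L\<rbrakk> \<Longrightarrow> lay l k \<theta> \<le> T" and "k \<le> L"
  shows "sqrt (1 + (vnorm (l k) (hid l relu \<theta> k x))\<^sup>2) \<le> sqrt (1 + T) ^ k * sqrt (1 + (vnorm (l 0) x)\<^sup>2)"
  using assms(2)
proof (induction k)
  case 0
  then show ?case by (simp add: hid_def)
next
  case (Suc k)
  let ?u = "1 + (vnorm (l k) (hid l relu \<theta> k x))\<^sup>2"
  have lT: "lay l (Suc k) \<theta> \<le> T" using assms(1)[of "Suc k"] Suc.prems by simp
  have T0: "0 \<le> T" using lT lay_nonneg[of l "Suc k" \<theta>] by linarith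
  have "vnorm (l (Suc k)) (hid l relu \<theta> (Suc k) x) \<le> vnorm (l (Suc k)) (realiz l relu \<theta> (Suc k) x)"
    by (rule vnorm_mono) (auto simp: hid_def relu_def)
  also have "\<dots> \<le> sqrt (lay l (Suc k) \<theta>) * sqrt ?u"
    unfolding realiz_Suc using vnorm_affine_le[of l "Suc k"] by simp
  also have "\<dots> \<le> sqrt T * sqrt ?u"
    using lT by (intro mult_right_mono) auto
  finally have "(vnorm (l (Suc k)) (hid l relu \<theta> (Suc k) x))\<^sup>2 \<le> (sqrt T * sqrt ?u)\<^sup>2"
    by (rule power_mono) (rule vnorm_nonneg)
  also have "\<dots> = T * ?u" using T0 by (simp add: power_mult_distrib)
  finally have "1 + (vnorm (l (Suc k)) (hid l relu \<theta> (Suc k) x))\<^sup>2 \<le> (1 + T) * ?u"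
    by (simp add: distrib_right add_increasing)
  from real_sqrt_le_mono[OF this] have
    "sqrt (1 + (vnorm (l (Suc k)) (hid l relu \<theta> (Suc k) x))\<^sup>2) \<le> sqrt (1 + T) * sqrt ?u"
    by (simp add: real_sqrt_mult)
  also have "\<dots> \<le> sqrt (1 + T) * (sqrt (1 + T) ^ k * sqrt (1 + (vnorm (l 0) x)\<^sup>2))"
    using Suc T0 by (intro mult_left_mono) auto
  finally show ?case by simp
qed

text \<open>Unrolling the recursion, each of the \<open>k\<close> layers injects one term, which
  after transport through the later layers amounts to \<open>q ^ (k - 1) * c\<close>. This serves
  both the derivative bound and the Lipschitz bound.\<close>

lemma recursion_bound:
  fixes err :: "nat \<Rightarrow> real"
  assumes "err 0 \<le> 0" and "\<And>k. k < L \<Longrightarrow> err (Suc k) \<le> q ^ k * c + q * err k"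
    and q: "0 \<le> q" and "k \<le> L"
  shows "err k \<le> real k * q ^ (k - 1) * c"
  using assms(4)
proof (induction k)
  case 0
  then show ?case using assms(1) by simp
next
  case (Suc k)
  have "err (Suc k) \<le> q ^ k * c + q * err k" using assms(2) Suc by simp
  also have "\<dots> \<le> q ^ k * c + q * (real k * q ^ (k - 1) * c)"
    using Suc q by (intro add_left_mono mult_left_mono) auto
  also have "\<dots> = real (Suc k) * q ^ (Suc k - 1) * c"
    by (cases k) (auto simp: algebra_simps)
  finally show ?case .
qed

text \<open>A perturbation of a layer has two sources: the change \<open>\<eta>\<close> of its own
  parameters acting on the incoming \<open>v\<close>, and the incoming perturbation \<open>w\<close>
  transported by \<open>\<theta>\<close>.\<close>

lemma layer_step_bound:
  assumes "lay l (Suc k) \<eta> \<le> \<delta>\<^sup>2" "lay l (Suc k) \<theta> \<le> T" "0 \<le> \<delta>"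
    and "sqrt (1 + (vnorm (l k) v)\<^sup>2) \<le> sqrt (1 + T) ^ k * u"
    and "vnorm (l k) w \<le> W"
  shows "vnorm (l (Suc k)) (\<lambda>i. affine l \<eta> (Suc k) v i + lin l \<theta> (Suc k) w i)
    \<le> sqrt (1 + T) ^ k * (\<delta> * u) + sqrt (1 + T) * W"
proof -
  have "vnorm (l (Suc k)) (\<lambda>i. affine l \<eta> (Suc k) v i + lin l \<theta> (Suc k) w i)
    \<le> vnorm (l (Suc k)) (affine l \<eta> (Suc k) v) + vnorm (l (Suc k)) (lin l \<theta> (Suc k) w)"
    by (rule vnorm_triangle)
  also have "vnorm (l (Suc k)) (affine l \<eta> (Suc k) v) \<le> sqrt (lay l (Suc k) \<eta>) * sqrt (1 + (vnorm (l k) v)\<^sup>2)"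
    using vnorm_affine_le[of l "Suc k" \<eta> v] by simp
  also have "\<dots> \<le> \<delta> * (sqrt (1 + T) ^ k * u)"
    using assms(1,3,4) real_sqrt_le_mono[OF assms(1)] by (intro mult_mono) auto
  also have "vnorm (l (Suc k)) (lin l \<theta> (Suc k) w) \<le> sqrt (lay l (Suc k) \<theta>) * vnorm (l k) w"
    using vnorm_lin_le[of l "Suc k" \<theta> w] by simp
  also have "\<dots> \<le> sqrt (1 + T) * W"
    using assms lay_nonneg[of l "Suc k" \<theta>] vnorm_nonneg[of "l k" w]
    by (intro mult_mono real_sqrt_le_mono) auto
  finally show ?thesis by (simp add: mult_ac)
qed

lemma drealiz_bound:
  assumes T: "\<And>k. \<lbrakk>1 \<le> k; k \<le> L\<rbrakk> \<Longrightarrow> lay l k \<theta> \<le> T"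
    and \<delta>: "\<And>k. \<lbrakk>1 \<le> k; k \<le> L\<rbrakk> \<Longrightarrow> lay l k \<eta> \<le> \<delta>\<^sup>2" "0 \<le> \<delta>" and "0 \<le> T"
  shows "vnorm (l L) (drealiz l relu heaviside \<theta> \<eta> L x)
    \<le> real L * sqrt (1 + T) ^ (L - 1) * (\<delta> * sqrt (1 + (vnorm (l 0) x)\<^sup>2))"
proof (rule recursion_bound[where L = L])
  fix k assume k: "k < L"
  show "vnorm (l (Suc k)) (drealiz l relu heaviside \<theta> \<eta> (Suc k) x)
    \<le> sqrt (1 + T) ^ k * (\<delta> * sqrt (1 + (vnorm (l 0) x)\<^sup>2))
      + sqrt (1 + T) * vnorm (l k) (drealiz l relu heaviside \<theta> \<eta> k x)"
    unfolding drealiz.simps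
  proof (rule layer_step_bound)
    show "sqrt (1 + (vnorm (l k) (hid l relu \<theta> k x))\<^sup>2) \<le> sqrt (1 + T) ^ k * sqrt (1 + (vnorm (l 0) x)\<^sup>2)"
      using k T by (intro hid_bound[where L = L]) auto
    \<comment> \<open>Masking components by 0 or 1 does not increase the norm.\<close>
    show "vnorm (l k) (\<lambda>j. heaviside k (realiz l relu \<theta> k x j) * drealiz l relu heaviside \<theta> \<eta> k x j)
      \<le> vnorm (l k) (drealiz l relu heaviside \<theta> \<eta> k x)"
      by (rule vnorm_mono) (auto simp: heaviside_def)
  qed (use k T \<delta> in auto)
qed (use assms in \<open>auto simp: vnorm_def\<close>)

lemma realiz_lipschitz:
  assumes T: "\<And>k. \<lbrakk>1 \<le> k; k \<le> L\<rbrakk> \<Longrightarrow> lay l k \<theta> \<le> T" "\<And>k. \<lbrakk>1 \<le> k; k \<le> L\<rbrakk> \<Longrightarrow> lay l k \<theta>' \<le> T"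
    and \<delta>: "\<And>k. \<lbrakk>1 \<le> k; k \<le> L\<rbrakk> \<Longrightarrow> lay l k (\<lambda>j. \<theta> j - \<theta>' j) \<le> \<delta>\<^sup>2" "0 \<le> \<delta>" and "0 \<le> T"
  shows "vnorm (l L) (\<lambda>i. realiz l relu \<theta> L x i - realiz l relu \<theta>' L x i)
    \<le> real L * sqrt (1 + T) ^ (L - 1) * (\<delta> * sqrt (1 + (vnorm (l 0) x)\<^sup>2))"
proof (rule recursion_bound[where L = L])
  fix k assume k: "k < L"
  \<comment> \<open>Discrete product rule: the parameters change at the old hidden values, then the
    hidden values change at the new parameters. Hence the same recursion as for
    \<open>drealiz\<close>.\<close>
  have eq: "(\<lambda>i. realiz l relu \<theta> (Suc k) x i - realiz l relu \<theta>' (Suc k) x i) =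
    (\<lambda>i. affine l (\<lambda>j. \<theta> j - \<theta>' j) (Suc k) (hid l relu \<theta> k x) i
      + lin l \<theta>' (Suc k) (\<lambda>j. hid l relu \<theta> k x j - hid l relu \<theta>' k x j) i)"
    unfolding realiz_Suc affine_def lin_def bias_def wgt_def
    by (simp add: fun_eq_iff algebra_simps sum.distrib sum_subtractf)
  show "vnorm (l (Suc k)) (\<lambda>i. realiz l relu \<theta> (Suc k) x i - realiz l relu \<theta>' (Suc k) x i)
    \<le> sqrt (1 + T) ^ k * (\<delta> * sqrt (1 + (vnorm (l 0) x)\<^sup>2))
      + sqrt (1 + T) * vnorm (l k) (\<lambda>i. realiz l relu \<theta> k x i - realiz l relu \<theta>' k x i)"
    unfolding eq
  proof (rule layer_step_bound)
    show "sqrt (1 + (vnorm (l k) (hid l relu \<theta> k x))\<^sup>2) \<le> sqrt (1 + T) ^ k * sqrt (1 + (vnorm (l 0) x)\<^sup>2)"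
      using k T by (intro hid_bound[where L = L]) auto
    show "vnorm (l k) (\<lambda>j. hid l relu \<theta> k x j - hid l relu \<theta>' k x j)
      \<le> vnorm (l k) (\<lambda>i. realiz l relu \<theta> k x i - realiz l relu \<theta>' k x i)"
      by (rule vnorm_mono) (auto simp: hid_def relu_def)
  qed (use k T \<delta> in auto)
qed (use assms in \<open>auto simp: vnorm_def\<close>)

section \<open>The squared loss and its gradient\<close>

definition sqloss :: "(nat \<Rightarrow> nat) \<Rightarrow> nat \<Rightarrow> (nat \<Rightarrow> real) \<Rightarrow> (nat \<Rightarrow> real \<Rightarrow> real) \<Rightarrow> (nat \<Rightarrow> real)
    \<Rightarrow> (nat \<Rightarrow> real) \<Rightarrow> real" where
  "sqloss l L \<xi> act \<theta> x = (vnorm (l L) (\<lambda>i. realiz l act \<theta> L x i - \<xi> i))\<^sup>2"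

text \<open>Assembled from forward derivatives along the unit vectors. With differentiable
  activations it is the true gradient, see \<open>sqloss_GDERIV\<close>; with \<open>relu\<close>
  and \<open>heaviside\<close> it is the generalized one.\<close>

definition rgrad :: "(nat \<Rightarrow> nat) \<Rightarrow> nat \<Rightarrow> (nat \<Rightarrow> real) \<Rightarrow> (nat \<Rightarrow> real \<Rightarrow> real) \<Rightarrow> (nat \<Rightarrow> real \<Rightarrow> real)
    \<Rightarrow> (nat \<Rightarrow> 'd::finite) \<Rightarrow> real^'d \<Rightarrow> (nat \<Rightarrow> real) \<Rightarrow> real^'d" where
  "rgrad l L \<xi> act act' e p x = (\<chi> c. 2 * (\<Sum>i=1..l L. (realiz l act (\<lambda>j. p $ e j) L x i - \<xi> i)
     * drealiz l act act' (\<lambda>j. p $ e j) (\<lambda>j. axis c 1 $ e j) L x i))"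

lemma drealiz_add:
  "drealiz l act act' \<theta> (\<lambda>j. \<eta> j + \<eta>' j) k x i
    = drealiz l act act' \<theta> \<eta> k x i + drealiz l act act' \<theta> \<eta>' k x i"
  by (induction k arbitrary: i)
    (simp_all add: affine_def lin_def bias_def wgt_def algebra_simps sum.distrib)

lemma drealiz_cmul:
  "drealiz l act act' \<theta> (\<lambda>j. c * \<eta> j) k x i = c * drealiz l act act' \<theta> \<eta> k x i"
  by (induction k arbitrary: i)
    (simp_all add: affine_def lin_def bias_def wgt_def algebra_simps sum_distrib_left)

text \<open>\<open>drealiz\<close> is linear in the direction, so the defining formula extends from
  unit vectors to every \<open>h\<close>. The norm bound, the Euler identity and the measurability
  of the gradient all go through this form.\<close>

lemma inner_rgrad:
  fixes p h :: "real^'d::finite"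
  shows "rgrad l L \<xi> act act' e p x \<bullet> h = 2 * (\<Sum>i=1..l L. (realiz l act (\<lambda>j. p $ e j) L x i - \<xi> i)
     * drealiz l act act' (\<lambda>j. p $ e j) (\<lambda>j. h $ e j) L x i)"
proof -
  define F where "F h = 2 * (\<Sum>i=1..l L. (realiz l act (\<lambda>j. p $ e j) L x i - \<xi> i)
     * drealiz l act act' (\<lambda>j. p $ e j) (\<lambda>j. h $ e j) L x i)" for h :: "real^'d"
  have lin: "linear F"
    unfolding F_def
    by (intro linearI) (simp_all add: drealiz_add drealiz_cmul algebra_simps sum.distrib
        sum_subtractf sum_distrib_left)
  have "F h = F (\<Sum>c\<in>UNIV. (h $ c) *\<^sub>R axis c 1)"
    using basis_expansion[of h] by (simp add: scalar_mult_eq_scaleR)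
  also have "\<dots> = (\<Sum>c\<in>UNIV. h $ c * F (axis c 1))"
    by (simp add: linear_sum[OF lin] linear_cmul[OF lin])
  also have "\<dots> = rgrad l L \<xi> act act' e p x \<bullet> h"
    by (simp add: inner_vec_def rgrad_def F_def mult.commute)
  finally show ?thesis by (simp add: F_def)
qed

lemma realiz_has_derivative:
  fixes p :: "real^'d::finite"
  assumes act: "\<And>k y. 1 \<le> k \<Longrightarrow> (act k has_real_derivative act' k y) (at y)"
  shows "((\<lambda>p. realiz l act (\<lambda>j. p $ e j) k x i) has_derivative
    (\<lambda>h. drealiz l act act' (\<lambda>j. p $ e j) (\<lambda>j. h $ e j) k x i)) (at p)"
proof (induction k arbitrary: i)
  case 0
  show ?case by simp
next
  case (Suc k)
  have hid: "((\<lambda>p. hid l act (\<lambda>j. p $ e j) k x i) has_derivative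
    (\<lambda>h. act' k (realiz l act (\<lambda>j. p $ e j) k x i)
      * drealiz l act act' (\<lambda>j. p $ e j) (\<lambda>j. h $ e j) k x i)) (at p)" for i
  proof (cases k)
    case (Suc k')
    then have "1 \<le> k" by simp
    from has_derivative_compose[OF Suc.IH act[OF this, unfolded has_field_derivative_def]] Suc
    show ?thesis by (simp add: hid_def)
  qed (simp add: hid_def)
  show ?case
    unfolding realiz_Suc drealiz.simps affine_def lin_def bias_def wgt_def
    by (rule derivative_eq_intros hid refl bounded_linear_imp_has_derivative
        bounded_linear_vec_nth | simp add: algebra_simps sum.distrib)+
qed

lemma sqloss_GDERIV:
  fixes p :: "real^'d::finite"
  assumes act: "\<And>k y. 1 \<le> k \<Longrightarrow> (act k has_real_derivative act' k y) (at y)"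
  shows "GDERIV (\<lambda>p. sqloss l L \<xi> act (\<lambda>j. p $ e j) x) p :> rgrad l L \<xi> act act' e p x"
  unfolding gderiv_def sqloss_def vnorm_sq inner_commute[of _ "rgrad _ _ _ _ _ _ _ _"] inner_rgrad
  by (rule derivative_eq_intros realiz_has_derivative[OF act] refl | assumption
      | simp add: sum_distrib_left mult_ac)+

text \<open>\<open>grad\<close> is a definite description, so evaluating it requires uniqueness,
  inherited from the Frechet derivative.\<close>

lemma grad_eqI: "GDERIV f x :> D \<Longrightarrow> grad f x = D"
  unfolding grad_def gderiv_def
proof (rule the_equality)
  fix D' assume "(f has_derivative (\<lambda>h. h \<bullet> D)) (at x)" "(f has_derivative (\<lambda>h. h \<bullet> D')) (at x)"
  then have "(\<lambda>h. h \<bullet> D) = (\<lambda>h. h \<bullet> D')" by (rule has_derivative_unique)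
  then show "D' = D" by (metis inner_commute vector_eq_rdot)
qed

section \<open>Removing the smoothing\<close>

locale smooth_relu =
  fixes Rf :: "real \<Rightarrow> real \<Rightarrow> real"
  assumes R_C1: "\<forall>r\<ge>1. \<exists>R'. continuous_on UNIV R' \<and> (\<forall>x. (Rf r has_real_derivative R' x) (at x))"
    and R_zero: "\<forall>r\<ge>1. \<forall>x. x \<le> 1 / (2 * r) \<longrightarrow> Rf r x = 0"
    and R_bounds: "\<forall>r\<ge>1. \<forall>y. 0 \<le> Rf r y \<and> Rf r y \<le> max y 0"
    and R_id: "\<forall>r\<ge>1. \<forall>z. z \<ge> 1 / r \<longrightarrow> Rf r z = z"
begin

definition act :: "real \<Rightarrow> nat \<Rightarrow> real \<Rightarrow> real" where
  "act r = (\<lambda>k. Rf (r powr (1 / real k)))"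

definition act' :: "real \<Rightarrow> nat \<Rightarrow> real \<Rightarrow> real" where
  "act' r k = deriv (Rf (r powr (1 / real k)))"

lemma Rf_has_derivative: "1 \<le> r \<Longrightarrow> (Rf r has_real_derivative deriv (Rf r) y) (at y)"
  using R_C1 DERIV_imp_deriv by metis

lemma act_has_derivative: "1 \<le> r \<Longrightarrow> (act r k has_real_derivative act' r k y) (at y)"
  \<comment> \<open>This includes \<open>k = 0\<close>, where \<open>1 / real k\<close> is 0 and the
    smoothing parameter becomes 1.\<close>
  unfolding act_def act'_def by (rule Rf_has_derivative) (simp add: ge_one_powr_ge_zero)

text \<open>The two functions differ only between 1 / (2r) and 1 / r, where both take values in
  [0, 1 / r].\<close>

lemma Rf_close: "1 \<le> r \<Longrightarrow> \<bar>Rf r y - max y 0\<bar> \<le> 1 / r"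
  using R_zero R_bounds R_id by (smt (verit) divide_nonneg_nonneg)

lemma deriv_Rf_eq_0: assumes "1 \<le> r" "y < 1 / (2 * r)" shows "deriv (Rf r) y = 0"
proof (rule DERIV_imp_deriv, rule has_field_derivative_transform_within_open)
  show "((\<lambda>_. 0) has_field_derivative 0) (at y)" by simp
  show "open {..<1 / (2 * r)}" "y \<in> {..<1 / (2 * r)}" using assms by auto
  show "\<And>x. x \<in> {..<1 / (2 * r)} \<Longrightarrow> 0 = Rf r x" using assms R_zero by simp
qed

lemma deriv_Rf_eq_1: assumes "1 \<le> r" "1 / r < y" shows "deriv (Rf r) y = 1"
proof (rule DERIV_imp_deriv, rule has_field_derivative_transform_within_open)
  show "((\<lambda>x. x) has_field_derivative 1) (at y)" by simp
  show "open {1 / r<..}" "y \<in> {1 / r<..}" using assms by auto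
  show "\<And>x. x \<in> {1 / r<..} \<Longrightarrow> x = Rf r x" using assms R_id by simp
qed

text \<open>The error in layer \<open>k\<close> is of smaller order than \<open>r powr (- 1 / k)\<close>, the width of the transition zone of the
  activation in that layer. So if the limiting preactivation is 0, the smoothed one eventually
  lies in the region where the activation vanishes identically, and the derivatives converge there too.\<close>
lemma realiz_rate:
  "((\<lambda>r. r powr (1 / real (Suc k)) * (realiz l (act r) \<theta> (Suc k) x i - realiz l relu \<theta> (Suc k) x i))
     \<longlongrightarrow> 0) at_top"
proof (induction k arbitrary: i)
  case 0
  show ?case by simp
next
  case (Suc k)
  let ?z = "\<lambda>r. realiz l (act r) \<theta> (Suc k) x" and ?y = "realiz l relu \<theta> (Suc k) x"
  let ?a = "1 / real (Suc k)" and ?b = "1 / real (Suc (Suc k))"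
  have hid: "((\<lambda>r. r powr ?b * (hid l (act r) \<theta> (Suc k) x j - hid l relu \<theta> (Suc k) x j)) \<longlongrightarrow> 0) at_top" for j
  proof (rule Lim_null_comparison)
    \<comment> \<open>The error entering the next layer is of order \<open>r powr (- ?a)\<close>;
      the strictly smaller exponent \<open>?b\<close> of that layer leaves a factor tending to
      0.\<close>
    have "?b < ?a" by (simp add: field_simps)
    then have p: "((\<lambda>r. r powr (?b - ?a)) \<longlongrightarrow> 0) at_top"
      by (intro tendsto_neg_powr filterlim_ident) simp
    have q: "((\<lambda>r. 1 + \<bar>r powr ?a * (?z r j - ?y j)\<bar>) \<longlongrightarrow> 1 + \<bar>0\<bar>) at_top"
      by (intro tendsto_intros Suc)
    show "((\<lambda>r. r powr (?b - ?a) * (1 + \<bar>r powr ?a * (?z r j - ?y j)\<bar>)) \<longlongrightarrow> 0) at_top"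
      using tendsto_mult[OF p q] by simp
    show "\<forall>\<^sub>F r in at_top. norm (r powr ?b * (hid l (act r) \<theta> (Suc k) x j - hid l relu \<theta> (Suc k) x j))
      \<le> r powr (?b - ?a) * (1 + \<bar>r powr ?a * (?z r j - ?y j)\<bar>)"
      using eventually_ge_at_top[of 1]
    proof eventually_elim
      case (elim r)
      let ?\<rho> = "r powr ?a"
      have \<rho>: "1 \<le> ?\<rho>" using elim by (simp add: ge_one_powr_ge_zero)
      \<comment> \<open>Split into the smoothing error of this activation and the propagated error,
        using that the ReLU is 1-Lipschitz.\<close>
      have "\<bar>hid l (act r) \<theta> (Suc k) x j - hid l relu \<theta> (Suc k) x j\<bar>
        \<le> \<bar>Rf ?\<rho> (?z r j) - max (?z r j) 0\<bar> + \<bar>max (?z r j) 0 - max (?y j) 0\<bar>"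
        by (simp add: hid_def act_def relu_def)
      also have "\<dots> \<le> 1 / ?\<rho> + \<bar>?z r j - ?y j\<bar>"
        using Rf_close[OF \<rho>, of "?z r j"] by (intro add_mono) auto
      also have "\<dots> = (1 / ?\<rho>) * (1 + ?\<rho> * \<bar>?z r j - ?y j\<bar>)"
        using elim by (simp add: field_simps)
      finally have "r powr ?b * \<bar>hid l (act r) \<theta> (Suc k) x j - hid l relu \<theta> (Suc k) x j\<bar>
        \<le> r powr ?b * ((1 / ?\<rho>) * (1 + ?\<rho> * \<bar>?z r j - ?y j\<bar>))"
        by (rule mult_left_mono) simp
      also have "\<dots> = r powr (?b - ?a) * (1 + ?\<rho> * \<bar>?z r j - ?y j\<bar>)"
        by (simp add: powr_diff)
      finally show ?case by (simp add: abs_mult)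
    qed
  qed
  have "((\<lambda>r. \<Sum>j=1..l (Suc k). wgt l \<theta> (Suc (Suc k)) i j *
      (r powr ?b * (hid l (act r) \<theta> (Suc k) x j - hid l relu \<theta> (Suc k) x j))) \<longlongrightarrow> (\<Sum>j=1..l (Suc k). wgt l \<theta> (Suc (Suc k)) i j * 0)) at_top"
    by (intro tendsto_sum tendsto_mult tendsto_const hid)
  then show ?case
    unfolding realiz_Suc affine_def
    by (simp add: algebra_simps sum_subtractf sum_distrib_left)
qed

lemma realiz_tendsto: "((\<lambda>r. realiz l (act r) \<theta> k x i) \<longlongrightarrow> realiz l relu \<theta> k x i) at_top"
proof (cases k)
  case (Suc k')
  have p: "((\<lambda>r. r powr (- (1 / real k))) \<longlongrightarrow> 0) at_top"
    by (intro tendsto_neg_powr filterlim_ident) (simp add: Suc)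
  have "((\<lambda>r. r powr (- (1 / real k)) * (r powr (1 / real k) * (realiz l (act r) \<theta> k x i - realiz l relu \<theta> k x i))) \<longlongrightarrow> 0) at_top"
    using tendsto_mult[OF p realiz_rate[of k' l \<theta> x i]] by (simp add: Suc)
  moreover have "\<forall>\<^sub>F r in at_top. r powr (- (1 / real k)) * (r powr (1 / real k) * (realiz l (act r) \<theta> k x i - realiz l relu \<theta> k x i))
    = realiz l (act r) \<theta> k x i - realiz l relu \<theta> k x i"
    using eventually_gt_at_top[of 0] by eventually_elim (simp add: powr_minus)
  ultimately have "((\<lambda>r. realiz l (act r) \<theta> k x i - realiz l relu \<theta> k x i) \<longlongrightarrow> 0) at_top"
    by (blast intro: Lim_transform_eventually)
  then show ?thesis by (rule LIM_zero_cancel)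
qed simp

text \<open>A positive limit eventually exceeds the transition zone, where the derivative is 1. For
  a limit \<le> 0, \<open>realiz_rate\<close> keeps the smoothed preactivation below the zone, where
  the derivative is 0. So equality holds eventually and not merely in the limit.\<close>

lemma act'_eventually:
  assumes k: "1 \<le> k"
  shows "\<forall>\<^sub>F r in at_top. act' r k (realiz l (act r) \<theta> k x i) = heaviside k (realiz l relu \<theta> k x i)"
proof -
  let ?z = "\<lambda>r. realiz l (act r) \<theta> k x i" and ?y = "realiz l relu \<theta> k x i" and ?a = "1 / real k"
  have rate: "((\<lambda>r. r powr ?a * (?z r - ?y)) \<longlongrightarrow> 0) at_top"
    using realiz_rate[of "k - 1"] k by simp
  show ?thesis
  proof (cases "0 < ?y")
    case True
    have "((\<lambda>r. r powr (- ?a)) \<longlongrightarrow> 0) at_top"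
      using k by (intro tendsto_neg_powr filterlim_ident) simp
    from tendsto_diff[OF realiz_tendsto[of l \<theta> k x i] this]
    have "\<forall>\<^sub>F r in at_top. 0 < ?z r - r powr (- ?a)"
      using True by (intro order_tendstoD(1)) auto
    then show ?thesis
      using eventually_ge_at_top[of 1]
    proof eventually_elim
      case (elim r)
      have \<rho>: "1 \<le> r powr ?a" using elim by (simp add: ge_one_powr_ge_zero)
      have "1 / r powr ?a < ?z r" using elim by (simp add: powr_minus inverse_eq_divide)
      then show ?case using deriv_Rf_eq_1[OF \<rho>] True by (simp add: act'_def heaviside_def)
    qed
  next
    case False
    \<comment> \<open>After scaling by \<open>r powr ?a\<close>, the activation vanishes identically
      up to 1 / 2.\<close>
    have "\<forall>\<^sub>F r in at_top. r powr ?a * (?z r - ?y) < 1 / 2"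
      using order_tendstoD(2)[OF rate, of "1 / 2"] by simp
    then show ?thesis
      using eventually_ge_at_top[of 1]
    proof eventually_elim
      case (elim r)
      have \<rho>: "1 \<le> r powr ?a" using elim by (simp add: ge_one_powr_ge_zero)
      have "r powr ?a * ?z r \<le> r powr ?a * (?z r - ?y)"
        using False \<rho> by (intro mult_left_mono) auto
      then have "?z r < 1 / (2 * r powr ?a)" using elim \<rho> by (simp add: field_simps)
      then show ?case using deriv_Rf_eq_0[OF \<rho>] False by (simp add: act'_def heaviside_def)
    qed
  qed
qed

lemma hid_tendsto: "((\<lambda>r. hid l (act r) \<theta> k x i) \<longlongrightarrow> hid l relu \<theta> k x i) at_top"
proof (cases "k = 0")
  case False
  then obtain k' where k': "k = Suc k'" using not0_implies_Suc by blast
  have p: "((\<lambda>r. r powr (- (1 / real k))) \<longlongrightarrow> 0) at_top"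
    by (intro tendsto_neg_powr filterlim_ident) (simp add: k')
  have "((\<lambda>r. act r k (realiz l (act r) \<theta> k x i) - max (realiz l (act r) \<theta> k x i) 0) \<longlongrightarrow> 0) at_top"
  proof (rule Lim_null_comparison[OF _ p])
    show "\<forall>\<^sub>F r in at_top. norm (act r k (realiz l (act r) \<theta> k x i) - max (realiz l (act r) \<theta> k x i) 0)
      \<le> r powr (- (1 / real k))"
      using eventually_ge_at_top[of 1]
    proof eventually_elim
      case (elim r)
      then show ?case
        using Rf_close[of "r powr (1 / real k)"]
        by (simp add: act_def powr_minus inverse_eq_divide ge_one_powr_ge_zero)
    qed
  qed
  from tendsto_add[OF this tendsto_max[OF realiz_tendsto[of l \<theta> k x i] tendsto_const[of 0]]]
  show ?thesis using False by (simp add: hid_def relu_def)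
qed (simp add: hid_def)

lemma drealiz_tendsto:
  "((\<lambda>r. drealiz l (act r) (act' r) \<theta> \<eta> k x i) \<longlongrightarrow> drealiz l relu heaviside \<theta> \<eta> k x i) at_top"
proof (induction k arbitrary: i)
  case (Suc k)
  have "((\<lambda>r. act' r k (realiz l (act r) \<theta> k x j) * drealiz l (act r) (act' r) \<theta> \<eta> k x j)
    \<longlongrightarrow> heaviside k (realiz l relu \<theta> k x j) * drealiz l relu heaviside \<theta> \<eta> k x j) at_top" for j
  \<comment> \<open>At \<open>k = 0\<close> both products vanish, as \<open>drealiz\<close> starts
    with 0; above it the activation factor is eventually constant.\<close>
  proof (cases "k = 0")
    case False
    then have "\<forall>\<^sub>F r in at_top. act' r k (realiz l (act r) \<theta> k x j) = heaviside k (realiz l relu \<theta> k x j)"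
      by (intro act'_eventually) simp
    from tendsto_mult[OF tendsto_eventually[OF this] Suc] show ?thesis .
  qed simp
  then show ?case
    unfolding drealiz.simps affine_def lin_def
    by (intro tendsto_add tendsto_sum tendsto_mult[OF tendsto_const] hid_tendsto tendsto_const)
qed simp

lemma rgrad_tendsto:
  "((\<lambda>r. rgrad l L \<xi> (act r) (act' r) e p x) \<longlongrightarrow> rgrad l L \<xi> relu heaviside e p x) at_top"
  unfolding rgrad_def by (intro vec_tendstoI) (simp, intro tendsto_intros realiz_tendsto drealiz_tendsto)

end

section \<open>The Lyapunov function\<close>

text \<open>The Lyapunov function \<open>lyap\<close> below is a weighted squared distance: weights of the network have
  coefficient 1, biases of layer \<open>k\<close> have coefficient \<open>k\<close>, and the centre is \<open>\<xi>\<close> in the biases of the last layer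
  and 0 elsewhere. The two definitions express this in terms of the flat parameter index \<open>q\<close>.\<close>
definition lyap_coef :: "(nat \<Rightarrow> nat) \<Rightarrow> nat \<Rightarrow> real" where
  "lyap_coef l q = (let k = LEAST k. q \<le> offs l (Suc k) in
     if l k * l (k-1) + offs l k < q then real k else 1)"

definition lyap_center :: "(nat \<Rightarrow> nat) \<Rightarrow> nat \<Rightarrow> (nat \<Rightarrow> real) \<Rightarrow> nat \<Rightarrow> real" where
  "lyap_center l L \<xi> q = (if l L * l (L-1) + offs l L < q then \<xi> (q - (l L * l (L-1) + offs l L)) else 0)"

lemma offs_Suc: "1 \<le> k \<Longrightarrow> offs l (Suc k) = offs l k + (l k * l (k-1) + l k)"
  by (cases k) (auto simp: offs_def)

lemma offs_mono: "k \<le> k' \<Longrightarrow> offs l k \<le> offs l k'"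
  unfolding offs_def by (rule sum_mono2) auto

lemma layer_eq:
  assumes "1 \<le> k" "offs l k < q" "q \<le> offs l (Suc k)"
  shows "(LEAST k. q \<le> offs l (Suc k)) = k"
proof (rule Least_equality)
  fix y assume "q \<le> offs l (Suc y)"
  then show "k \<le> y" using assms(2) offs_mono[of "Suc y" k l] by linarith
qed (rule assms)

lemma wgt_index_le:
  assumes "1 \<le> i" "i \<le> m" "j \<le> n"
  shows "(i - 1) * n + j \<le> m * (n::nat)"
proof -
  have "(i - 1) * n + j \<le> (i - 1) * n + n" using assms by simp
  also have "\<dots> = i * n" using assms by (cases i) auto
  also have "\<dots> \<le> m * n" using assms by simp
  finally show ?thesis .
qed

lemma wgt_lyap_coef:
  assumes "1 \<le> k" "1 \<le> i" "i \<le> l k" "1 \<le> j" "j \<le> l (k-1)"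
  shows "wgt l (lyap_coef l) k i j = 1"
proof -
  have "(i - 1) * l (k-1) + j \<le> l k * l (k-1)" using assms by (intro wgt_index_le) auto
  then show ?thesis
    using layer_eq[of k l "(i - 1) * l (k-1) + j + offs l k"] offs_Suc[of k l] assms
    by (simp add: wgt_def lyap_coef_def Let_def)
qed

lemma bias_lyap_coef:
  assumes "1 \<le> k" "1 \<le> i" "i \<le> l k"
  shows "bias l (lyap_coef l) k i = real k"
  using layer_eq[of k l "l k * l (k-1) + i + offs l k"] offs_Suc[of k l] assms
  by (simp add: bias_def lyap_coef_def Let_def)

lemma wgt_lyap_center:
  assumes "1 \<le> k" "k \<le> L" "1 \<le> i" "i \<le> l k" "1 \<le> j" "j \<le> l (k-1)"
  shows "wgt l (lyap_center l L \<xi>) k i j = 0"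
proof -
  have "(i - 1) * l (k-1) + j \<le> l k * l (k-1)" using assms by (intro wgt_index_le) auto
  moreover have "k \<noteq> L \<Longrightarrow> offs l (Suc k) \<le> offs l L" using assms by (intro offs_mono) auto
  ultimately have "(i - 1) * l (k-1) + j + offs l k \<le> l L * l (L-1) + offs l L"
    using offs_Suc[of k l] assms by (cases "k = L") auto
  then show ?thesis by (simp add: wgt_def lyap_center_def)
qed

lemma bias_lyap_center:
  assumes "1 \<le> k" "k \<le> L" "1 \<le> i" "i \<le> l k"
  shows "bias l (lyap_center l L \<xi>) k i = (if k = L then \<xi> i else 0)"
proof -
  have "k \<noteq> L \<Longrightarrow> offs l (Suc k) \<le> offs l L" using assms by (intro offs_mono) auto
  then show ?thesis using offs_Suc[of k l] assms by (auto simp: bias_def lyap_center_def)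
qed

lemma lyap_coef_bounds:
  assumes "1 \<le> q" "q \<le> offs l (Suc L)" "1 \<le> L"
  shows "1 \<le> lyap_coef l q" "lyap_coef l q \<le> real L"
proof -
  let ?k = "LEAST k. q \<le> offs l (Suc k)"
  have "?k \<le> L" using assms by (intro Least_le) simp
  moreover have "q \<le> offs l (Suc ?k)" by (rule LeastI) (rule assms)
  \<comment> \<open>Layers are counted from 1: \<open>offs l (Suc 0)\<close> is 0, whereas
    \<open>q\<close> is positive.\<close>
  then have "?k \<noteq> 0" using assms by (auto simp: offs_def intro: ccontr)
  ultimately show "1 \<le> lyap_coef l q" "lyap_coef l q \<le> real L"
    using assms unfolding lyap_coef_def Let_def by auto
qed

text \<open>Euler's identity: scaling the weights by \<open>t\<close> and the biases of layer \<open>k\<close> by \<open>t ^ k\<close> multiplies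
  the output of layer \<open>k\<close> by \<open>t ^ k\<close>, as \<open>relu\<close> is positively homogeneous.\<close>
lemma drealiz_euler:
  assumes w: "\<And>k i j. \<lbrakk>1 \<le> k; k \<le> n; 1 \<le> i; i \<le> l k; 1 \<le> j; j \<le> l (k-1)\<rbrakk> \<Longrightarrow> wgt l \<eta> k i j = 2 * wgt l \<theta> k i j"
    and b: "\<And>k i. \<lbrakk>1 \<le> k; k \<le> n; 1 \<le> i; i \<le> l k\<rbrakk> \<Longrightarrow> bias l \<eta> k i = 2 * real k * (bias l \<theta> k i - c k i)"
    and c: "\<And>k i. k < n \<Longrightarrow> c k i = 0"
    and k: "k \<le> n" and i: "1 \<le> i" "i \<le> l k"
  shows "drealiz l relu heaviside \<theta> \<eta> k x i = 2 * real k * (realiz l relu \<theta> k x i - c k i)"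
  using k i
proof (induction k arbitrary: i)
  case (Suc k)
  have hid: "heaviside k (realiz l relu \<theta> k x j) * drealiz l relu heaviside \<theta> \<eta> k x j
    = 2 * real k * hid l relu \<theta> k x j" if "j \<in> {1..l k}" for j
  proof -
    \<comment> \<open>Below the last layer the centre \<open>c\<close> is 0, so the induction
      hypothesis is purely homogeneous.\<close>
    have "drealiz l relu heaviside \<theta> \<eta> k x j = 2 * real k * realiz l relu \<theta> k x j"
      using Suc.IH[of j] Suc.prems that c[of k j] by simp
    moreover have "heaviside k y * y = relu k y" for y
      by (simp add: heaviside_def relu_def)
    ultimately show ?thesis by (simp add: hid_def mult.left_commute)
  qed
  have w': "wgt l \<eta> (Suc k) i j = 2 * wgt l \<theta> (Suc k) i j" if "j \<in> {1..l k}" for j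
    using w[of "Suc k" i j] Suc.prems that by simp
  let ?S = "\<Sum>j=1..l k. wgt l \<theta> (Suc k) i j * hid l relu \<theta> k x j"
  \<comment> \<open>The layer's own weights contribute \<open>2 * ?S\<close> and the propagated part
    \<open>2 * real k * ?S\<close>. The total factor \<open>2 * real (Suc k)\<close> must also
    appear at the bias, which is why biases are weighted by their layer number.\<close>
  have "affine l \<eta> (Suc k) (hid l relu \<theta> k x) i = 2 * real (Suc k) * (bias l \<theta> (Suc k) i - c (Suc k) i) + 2 * ?S"
    using b[of "Suc k" i] Suc.prems by (simp add: affine_def w' sum_distrib_left mult_ac)
  moreover have "lin l \<theta> (Suc k) (\<lambda>j. heaviside k (realiz l relu \<theta> k x j) * drealiz l relu heaviside \<theta> \<eta> k x j) i
    = 2 * real k * ?S"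
    unfolding lin_def sum_distrib_left diff_Suc_1
    by (intro sum.cong refl, subst hid) (simp_all add: mult_ac)
  moreover have "realiz l relu \<theta> (Suc k) x i = bias l \<theta> (Suc k) i + ?S"
    by (simp add: realiz_Suc affine_def)
  ultimately show ?case by (simp add: algebra_simps)
qed simp

section \<open>The Lyapunov function on the parameter space\<close>

locale network =
  fixes l :: "nat \<Rightarrow> nat" and L :: nat and \<xi> :: "nat \<Rightarrow> real" and e :: "nat \<Rightarrow> 'd::finite"
  assumes L_pos: "1 \<le> L" and e_bij: "bij_betw e {1..offs l (Suc L)} (UNIV :: 'd set)"
begin

abbreviation params :: "real^'d \<Rightarrow> nat \<Rightarrow> real" where
  "params p \<equiv> (\<lambda>j. p $ e j)"

abbreviation loss :: "real^'d \<Rightarrow> (nat \<Rightarrow> real) \<Rightarrow> real" where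
  "loss p \<equiv> sqloss l L \<xi> relu (params p)"

abbreviation sgrad :: "real^'d \<Rightarrow> (nat \<Rightarrow> real) \<Rightarrow> real^'d" where
  "sgrad \<equiv> rgrad l L \<xi> relu heaviside e"

text \<open>A right inverse of \<open>params\<close> on the index range, by
  \<open>vec_of_nth\<close>.\<close>

definition vec_of :: "(nat \<Rightarrow> real) \<Rightarrow> real^'d" where
  "vec_of f = (\<chi> c. f (inv_into {1..offs l (Suc L)} e c))"

lemma vec_of_nth: "1 \<le> q \<Longrightarrow> q \<le> offs l (Suc L) \<Longrightarrow> vec_of f $ e q = f q"
  using bij_betw_inv_into_left[OF e_bij, of q] by (simp add: vec_of_def)

lemma bias_in_range:
  assumes "1 \<le> k" "k \<le> L" "i \<le> l k"
  shows "l k * l (k-1) + i + offs l k \<le> offs l (Suc L)"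
  using offs_Suc[of k l] offs_mono[of "Suc k" "Suc L" l] assms by simp

lemma wgt_in_range:
  assumes "1 \<le> k" "k \<le> L" "1 \<le> i" "i \<le> l k" "j \<le> l (k-1)"
  shows "(i-1) * l (k-1) + j + offs l k \<le> offs l (Suc L)"
  using wgt_index_le[of i "l k" j "l (k-1)"] bias_in_range[of k 0] assms by simp

definition center :: "real^'d" where "center = vec_of (lyap_center l L \<xi>)"

definition lyap :: "real^'d \<Rightarrow> real" where
  "lyap p = (\<Sum>q=1..offs l (Suc L). lyap_coef l q * ((p - center) $ e q)\<^sup>2)"

text \<open>The Euclidean gradient of \<open>lyap\<close>; it arises as the linear coefficient in
  the expansion behind \<open>lyap_step\<close>.\<close>

definition lyap_grad :: "real^'d \<Rightarrow> real^'d" where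
  "lyap_grad p = vec_of (\<lambda>q. 2 * lyap_coef l q * (p - center) $ e q)"

lemma norm_sq_params: "(norm p)\<^sup>2 = (\<Sum>q=1..offs l (Suc L). (p $ e q)\<^sup>2)" for p :: "real^'d"
  unfolding power2_norm_eq_inner inner_sum_params[OF e_bij] by (simp add: power2_eq_square)

lemma norm_center: "norm center = vnorm (l L) \<xi>"
proof -
  have "(norm center)\<^sup>2 = (\<Sum>k=1..L. lay l k (lyap_center l L \<xi>))"
  proof -
    have "(norm center)\<^sup>2 = (\<Sum>q=1..offs l (Suc L). (lyap_center l L \<xi> q)\<^sup>2)"
      unfolding norm_sq_params by (rule sum.cong) (auto simp: center_def vec_of_nth)
    then show ?thesis
      unfolding sum_params by (simp add: lay_def bias_def wgt_def)
  qed
  also have "\<dots> = (\<Sum>k=1..L. if k = L then \<Sum>i=1..l L. (\<xi> i)\<^sup>2 else 0)"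
    unfolding lay_def by (rule sum.cong) (auto simp: wgt_lyap_center bias_lyap_center)
  also have "\<dots> = (vnorm (l L) \<xi>)\<^sup>2"
    using L_pos by (simp add: vnorm_sq)
  finally show ?thesis by (simp add: vnorm_nonneg)
qed

text \<open>The coefficients lie between 1 and \<open>L\<close>, so \<open>lyap\<close> is
  comparable to the squared distance from \<open>center\<close>; this is the lower half,
  \<open>lyap_le\<close> the upper.\<close>

lemma lyap_ge: "(norm (p - center))\<^sup>2 \<le> lyap p"
proof -
  have "1 * ((p - center) $ e q)\<^sup>2 \<le> lyap_coef l q * ((p - center) $ e q)\<^sup>2"
    if "q \<in> {1..offs l (Suc L)}" for q
    using lyap_coef_bounds[of q l L] that L_pos by (intro mult_right_mono) auto
  then show ?thesis unfolding norm_sq_params lyap_def by (simp only: mult_1 sum_mono)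
qed

lemma lyap_coef_sum_le:
  fixes p :: "real^'d"
  shows "(\<Sum>q=1..offs l (Suc L). lyap_coef l q * (p $ e q)\<^sup>2) \<le> real L * (norm p)\<^sup>2"
  unfolding norm_sq_params sum_distrib_left
  using lyap_coef_bounds[of _ l L] L_pos by (intro sum_mono mult_right_mono) auto

lemma lyap_le: "lyap p \<le> real L * (norm (p - center))\<^sup>2"
  unfolding lyap_def by (rule lyap_coef_sum_le)

text \<open>\<open>lyap\<close> is quadratic, so its second-order expansion is exact; only the
  quadratic term is estimated, by bounding the coefficients by \<open>L\<close>.\<close>

lemma lyap_step: "lyap (p - t *\<^sub>R g) \<le> lyap p - t * (g \<bullet> lyap_grad p) + t\<^sup>2 * (real L * (norm g)\<^sup>2)"
proof -
  have ig: "g \<bullet> lyap_grad p = (\<Sum>q=1..offs l (Suc L). g $ e q * (2 * lyap_coef l q * (p - center) $ e q))"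
    unfolding inner_sum_params[OF e_bij] lyap_grad_def
    by (intro sum.cong refl) (simp add: vec_of_nth)
  have "lyap (p - t *\<^sub>R g) = lyap p - t * (g \<bullet> lyap_grad p)
    + t\<^sup>2 * (\<Sum>q=1..offs l (Suc L). lyap_coef l q * (g $ e q)\<^sup>2)"
    unfolding lyap_def ig sum_distrib_left sum_subtractf[symmetric] sum.distrib[symmetric]
    by (intro sum.cong refl) (simp add: power2_eq_square algebra_simps)
  also have "\<dots> \<le> lyap p - t * (g \<bullet> lyap_grad p) + t\<^sup>2 * (real L * (norm g)\<^sup>2)"
    by (intro add_left_mono mult_left_mono lyap_coef_sum_le) simp
  finally show ?thesis .
qed

text \<open>\<open>lyap_grad p\<close> is the direction in Euler's identity, along which the output
  changes by \<open>2 * real L\<close> times the residual. Pairing this with twice the residual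
  gives the factor \<open>4 * real L\<close>.\<close>

lemma sgrad_inner_lyap_grad: "sgrad p x \<bullet> lyap_grad p = 4 * real L * loss p x"
proof -
  \<comment> \<open>The test \<open>L = L\<close> is what the centre \<open>c\<close> of
    \<open>drealiz_euler\<close> becomes in layer \<open>L\<close>.\<close>
  have "drealiz l relu heaviside (params p) (params (lyap_grad p)) L x i
    = 2 * real L * (realiz l relu (params p) L x i - (if L = L then \<xi> i else 0))" if "i \<in> {1..l L}" for i
  proof (rule drealiz_euler[where c = "\<lambda>k i. if k = L then \<xi> i else 0" and n = L])
    fix k i j assume *: "1 \<le> k" "k \<le> L" "1 \<le> i" "i \<le> l k" "1 \<le> j" "j \<le> l (k-1)"
    show "wgt l (params (lyap_grad p)) k i j = 2 * wgt l (params p) k i j"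
      using wgt_in_range[of k i j] wgt_lyap_coef[of k i l j] wgt_lyap_center[of k L i l j \<xi>] *
      by (simp add: wgt_def lyap_grad_def center_def vec_of_nth)
  next
    fix k i assume *: "1 \<le> k" "k \<le> L" "1 \<le> i" "i \<le> l k"
    show "bias l (params (lyap_grad p)) k i = 2 * real k * (bias l (params p) k i - (if k = L then \<xi> i else 0))"
      using bias_in_range[of k i] bias_lyap_coef[of k i l] bias_lyap_center[of k L i l \<xi>] *
      by (simp add: bias_def lyap_grad_def center_def vec_of_nth)
  qed (use that in auto)
  note eq = this
  show ?thesis
    unfolding inner_rgrad sqloss_def vnorm_sq sum_distrib_left
    by (intro sum.cong refl, subst eq) (simp_all add: power2_eq_square algebra_simps)
qed

section \<open>Gradient and Lipschitz bounds on balls\<close>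

definition lipc :: "real \<Rightarrow> (nat \<Rightarrow> real) \<Rightarrow> real" where
  "lipc T x = real L * sqrt (1 + T) ^ (L - 1) * sqrt (1 + (vnorm (l 0) x)\<^sup>2)"

lemma lipc_nonneg: "0 \<le> T \<Longrightarrow> 0 \<le> lipc T x"
  by (simp add: lipc_def)

lemma lay_le:
  fixes p :: "real^'d"
  assumes "(norm p)\<^sup>2 \<le> T" "1 \<le> k" "k \<le> L"
  shows "lay l k (params p) \<le> T"
  using lay_le_norm_sq[OF e_bij assms(2,3), of p] assms(1) by simp

lemma lay_diff_le:
  fixes p p' :: "real^'d"
  assumes "1 \<le> k" "k \<le> L"
  shows "lay l k (\<lambda>j. p $ e j - p' $ e j) \<le> (norm (p - p'))\<^sup>2"
  using lay_le_norm_sq[OF e_bij assms, of "p - p'"] by simp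

text \<open>Take the directional derivative along the gradient itself: Cauchy-Schwarz bounds the
  squared norm by twice the residual norm times \<open>lipc T x * norm ?g\<close>, and one factor
  \<open>norm ?g\<close> cancels.\<close>

lemma norm_sgrad_le:
  assumes "(norm p)\<^sup>2 \<le> T"
  shows "(norm (sgrad p x))\<^sup>2 \<le> 4 * loss p x * (lipc T x)\<^sup>2"
proof -
  let ?g = "sgrad p x" and ?D = "\<lambda>i. realiz l relu (params p) L x i - \<xi> i"
  have T0: "0 \<le> T" by (rule order_trans[OF zero_le_power2 assms(1)])
  have "vnorm (l L) (drealiz l relu heaviside (params p) (params ?g) L x)
    \<le> real L * sqrt (1 + T) ^ (L - 1) * (norm ?g * sqrt (1 + (vnorm (l 0) x)\<^sup>2))"
    by (rule drealiz_bound) (use lay_le[OF assms] lay_le_norm_sq[OF e_bij] T0 in auto)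
  then have d: "vnorm (l L) (drealiz l relu heaviside (params p) (params ?g) L x) \<le> lipc T x * norm ?g"
    by (simp add: lipc_def mult_ac)
  have "(norm ?g)\<^sup>2 = 2 * (\<Sum>i=1..l L. ?D i * drealiz l relu heaviside (params p) (params ?g) L x i)"
    unfolding power2_norm_eq_inner by (rule inner_rgrad)
  moreover have "(\<Sum>i=1..l L. ?D i * drealiz l relu heaviside (params p) (params ?g) L x i)
    \<le> (\<Sum>i=1..l L. \<bar>?D i\<bar> * \<bar>drealiz l relu heaviside (params p) (params ?g) L x i\<bar>)"
    unfolding abs_mult[symmetric] by (intro sum_mono abs_ge_self)
  moreover have "\<dots> \<le> vnorm (l L) ?D * vnorm (l L) (drealiz l relu heaviside (params p) (params ?g) L x)"
    unfolding vnorm_eq_L2_set by (rule L2_set_mult_ineq)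
  moreover have "\<dots> \<le> vnorm (l L) ?D * (lipc T x * norm ?g)"
    by (rule mult_left_mono[OF d vnorm_nonneg])
  ultimately have "(norm ?g)\<^sup>2 \<le> 2 * (vnorm (l L) ?D * (lipc T x * norm ?g))"
    by linarith
  then have "norm ?g * norm ?g \<le> (2 * vnorm (l L) ?D * lipc T x) * norm ?g"
    by (simp add: power2_eq_square)
  then have "norm ?g \<le> 2 * vnorm (l L) ?D * lipc T x"
    using lipc_nonneg[OF T0, of x] vnorm_nonneg[of "l L" ?D]
    by (cases "norm ?g = 0") auto
  then have "(norm ?g)\<^sup>2 \<le> (2 * vnorm (l L) ?D * lipc T x)\<^sup>2"
    by (rule power_mono) simp
  then show ?thesis by (simp add: sqloss_def power_mult_distrib)
qed

lemma vnorm_diff_le: "vnorm n (\<lambda>i. v i - w i) \<le> vnorm n v + vnorm n w"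
  using vnorm_triangle[of n v "\<lambda>i. - w i"] by (simp add: vnorm_def)

text \<open>Compare with the network whose parameters are all 0: its output is 0, and its distance
  from \<open>p\<close> is at most \<open>sqrt T\<close>.\<close>

lemma residual_le:
  assumes "(norm p)\<^sup>2 \<le> T"
  shows "vnorm (l L) (\<lambda>i. realiz l relu (params p) L x i - \<xi> i) \<le> lipc T x * sqrt T + vnorm (l L) \<xi>"
proof -
  have T0: "0 \<le> T" by (rule order_trans[OF zero_le_power2 assms(1)])
  have eq: "realiz l relu (\<lambda>j. 0) L x = (\<lambda>i. 0)"
  proof -
    obtain L' where "L = Suc L'" using L_pos by (cases L) auto
    then show ?thesis by (simp add: realiz_Suc affine_def bias_def wgt_def)
  qed
  have zero: "lay l k (\<lambda>j. 0) = 0" for k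
    by (simp add: lay_def bias_def wgt_def)
  have "vnorm (l L) (\<lambda>i. realiz l relu (params p) L x i - realiz l relu (\<lambda>j. 0) L x i)
    \<le> real L * sqrt (1 + T) ^ (L - 1) * (sqrt T * sqrt (1 + (vnorm (l 0) x)\<^sup>2))"
    by (rule realiz_lipschitz) (use lay_le[OF assms] T0 in \<open>auto simp: zero\<close>)
  with vnorm_diff_le[of "l L" "realiz l relu (params p) L x" \<xi>] show ?thesis
    by (simp add: eq lipc_def mult_ac)
qed

text \<open>Factor the difference of squared residual norms: the difference is Lipschitz by
  \<open>realiz_lipschitz\<close>, the sum is bounded by \<open>residual_le\<close>.\<close>

lemma loss_lipschitz:
  assumes p: "(norm p)\<^sup>2 \<le> T" "(norm p')\<^sup>2 \<le> T"
  shows "\<bar>loss p x - loss p' x\<bar> \<le> 2 * lipc T x * (lipc T x * sqrt T + vnorm (l L) \<xi>) * norm (p - p')"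
proof -
  let ?D = "\<lambda>p. vnorm (l L) (\<lambda>i. realiz l relu (params p) L x i - \<xi> i)"
  have T0: "0 \<le> T" by (rule order_trans[OF zero_le_power2 assms(1)])
  have ty: "vnorm (l L) (\<lambda>i. realiz l relu (params p) L x i - realiz l relu (params p') L x i)
    \<le> lipc T x * norm (p - p')" if "(norm p)\<^sup>2 \<le> T" "(norm p')\<^sup>2 \<le> T" for p p'
  proof -
    have "vnorm (l L) (\<lambda>i. realiz l relu (params p) L x i - realiz l relu (params p') L x i)
      \<le> real L * sqrt (1 + T) ^ (L - 1) * (norm (p - p') * sqrt (1 + (vnorm (l 0) x)\<^sup>2))"
      by (rule realiz_lipschitz) (use lay_le[OF that(1)] lay_le[OF that(2)] lay_diff_le T0 in auto)
    then show ?thesis by (simp add: lipc_def mult_ac)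
  qed
  have tri: "?D p \<le> ?D p' + lipc T x * norm (p - p')" if "(norm p)\<^sup>2 \<le> T" "(norm p')\<^sup>2 \<le> T" for p p'
    using vnorm_triangle[of "l L" "\<lambda>i. realiz l relu (params p') L x i - \<xi> i"
        "\<lambda>i. realiz l relu (params p) L x i - realiz l relu (params p') L x i"] ty[OF that]
    by simp
  have "\<bar>?D p - ?D p'\<bar> \<le> lipc T x * norm (p - p')"
    using tri[OF p] tri[OF p(2) p(1)] by (auto simp: abs_le_iff norm_minus_commute)
  moreover have "\<bar>?D p + ?D p'\<bar> \<le> 2 * (lipc T x * sqrt T + vnorm (l L) \<xi>)"
    using residual_le[OF p(1), of x] residual_le[OF p(2), of x]
      vnorm_nonneg[of "l L" "\<lambda>i. realiz l relu (params p) L x i - \<xi> i"]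
      vnorm_nonneg[of "l L" "\<lambda>i. realiz l relu (params p') L x i - \<xi> i"] by simp
  ultimately have "\<bar>?D p - ?D p'\<bar> * \<bar>?D p + ?D p'\<bar> \<le> lipc T x * norm (p - p') * (2 * (lipc T x * sqrt T + vnorm (l L) \<xi>))"
    by (intro mult_mono) (auto simp: lipc_nonneg[OF T0])
  then show ?thesis
    unfolding abs_mult[symmetric] sqloss_def by (simp add: power2_eq_square algebra_simps)
qed

end

text \<open>The increments of \<open>u\<^sup>2\<close> are absolutely summable, so \<open>u\<close> converges.\<close>
lemma tendsto_0_of_summable_steps:
  fixes u t :: "nat \<Rightarrow> real"
  assumes u: "\<And>n. 0 \<le> u n" and t: "\<And>n. 0 \<le> t n"
    and sum: "summable (\<lambda>n. t n * u n)" and div: "\<not> summable t"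
    and lip: "\<And>n. \<bar>u (Suc n) - u n\<bar> \<le> C * t n"
    and sq: "summable (\<lambda>n. (u (Suc n) - u n)\<^sup>2)"
  shows "u \<longlonglongrightarrow> 0"
proof -
  have bnd: "norm ((u (Suc n))\<^sup>2 - (u n)\<^sup>2) \<le> 2 * C * (t n * u n) + (u (Suc n) - u n)\<^sup>2" for n
  proof -
    \<comment> \<open>The linear term is controlled by \<open>t n * u n\<close> through
      \<open>lip\<close>, the quadratic one is summable by \<open>sq\<close>.\<close>
    have "(u (Suc n))\<^sup>2 - (u n)\<^sup>2 = 2 * u n * (u (Suc n) - u n) + (u (Suc n) - u n)\<^sup>2"
      by (simp add: power2_eq_square algebra_simps)
    then have "\<bar>(u (Suc n))\<^sup>2 - (u n)\<^sup>2\<bar> \<le> \<bar>2 * u n * (u (Suc n) - u n)\<bar> + (u (Suc n) - u n)\<^sup>2"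
      using abs_triangle_ineq[of "2 * u n * (u (Suc n) - u n)" "(u (Suc n) - u n)\<^sup>2"] by simp
    moreover have "\<bar>2 * u n * (u (Suc n) - u n)\<bar> = 2 * u n * \<bar>u (Suc n) - u n\<bar>"
      using u[of n] by (simp add: abs_mult)
    moreover have "\<dots> \<le> 2 * u n * (C * t n)"
      using u[of n] lip[of n] by (intro mult_left_mono) auto
    ultimately show ?thesis by (simp add: mult_ac)
  qed
  have "summable (\<lambda>n. (u (Suc n))\<^sup>2 - (u n)\<^sup>2)"
    by (rule summable_comparison_test'[OF summable_add[OF summable_mult[OF sum, of "2 * C"] sq] bnd])
  then have "convergent (\<lambda>n. \<Sum>k<n. (u (Suc k))\<^sup>2 - (u k)\<^sup>2)"
    by (simp add: summable_iff_convergent)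
  then have "convergent (\<lambda>n. (u n)\<^sup>2 - (u 0)\<^sup>2)"
    using sum_lessThan_telescope[of "\<lambda>n. (u n)\<^sup>2"] by simp
  then have "convergent (\<lambda>n. (u n)\<^sup>2)" by (simp add: convergent_diff_const_right_iff)
  then obtain c where "(\<lambda>n. (u n)\<^sup>2) \<longlonglongrightarrow> c" by (auto simp: convergent_def)
  then have "(\<lambda>n. sqrt ((u n)\<^sup>2)) \<longlonglongrightarrow> sqrt c" by (rule tendsto_real_sqrt)
  then have lim: "u \<longlonglongrightarrow> sqrt c" using u by simp
  have "0 \<le> sqrt c" by (rule LIMSEQ_le_const[OF lim]) (use u in auto)
  \<comment> \<open>A positive limit would eventually dominate \<open>t n\<close> by a multiple of
    \<open>t n * u n\<close> and make \<open>t\<close> summable.\<close>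
  moreover have "\<not> 0 < sqrt c"
  proof
    assume pos: "0 < sqrt c"
    then have "\<forall>\<^sub>F n in sequentially. sqrt c / 2 < u n"
      by (intro order_tendstoD(1)[OF lim]) auto
    then have "\<forall>\<^sub>F n in sequentially. norm (t n) \<le> (2 / sqrt c) * (t n * u n)"
    proof eventually_elim
      case (elim n)
      then have "t n * (sqrt c / 2) \<le> t n * u n" using t[of n] by (intro mult_left_mono) auto
      then show ?case using pos t[of n] by (simp add: field_simps)
    qed
    then have "summable t"
      by (rule summable_comparison_test_ev) (intro summable_mult sum)
    with div show False by simp
  qed
  ultimately show ?thesis using lim by simp
qed

section \<open>Batch gradients and descent along a trajectory\<close>

context network begin

definition bgrad :: "nat \<Rightarrow> (nat \<Rightarrow> nat \<Rightarrow> real) \<Rightarrow> real^'d \<Rightarrow> real^'d" where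
  "bgrad M x p = (1 / real M) *\<^sub>R (\<Sum>m=1..M. sgrad p (x m))"

definition bloss :: "nat \<Rightarrow> (nat \<Rightarrow> nat \<Rightarrow> real) \<Rightarrow> real^'d \<Rightarrow> real" where
  "bloss M x p = (1 / real M) * (\<Sum>m=1..M. loss p (x m))"

lemma bgrad_inner_lyap_grad: "bgrad M x p \<bullet> lyap_grad p = 4 * real L * bloss M x p"
  by (simp add: bgrad_def bloss_def inner_sum_left sgrad_inner_lyap_grad sum_distrib_left sum_divide_distrib)

lemma loss_nonneg: "0 \<le> loss p x"
  by (simp add: sqloss_def)

lemma bloss_nonneg: "0 \<le> bloss M x p"
  by (simp add: bloss_def sum_nonneg loss_nonneg)

text \<open>The squared norm of a mean is at most the mean of the squared norms; then apply
  \<open>norm_sgrad_le\<close> to each sample.\<close>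

lemma norm_bgrad_le:
  assumes M: "1 \<le> M" and p: "(norm p)\<^sup>2 \<le> T"
    and x: "\<And>m. \<lbrakk>1 \<le> m; m \<le> M\<rbrakk> \<Longrightarrow> (lipc T (x m))\<^sup>2 \<le> K"
  shows "(norm (bgrad M x p))\<^sup>2 \<le> 4 * K * bloss M x p"
proof -
  have "(norm (\<Sum>m=1..M. sgrad p (x m)))\<^sup>2 \<le> (\<Sum>m=1..M. norm (sgrad p (x m)))\<^sup>2"
    by (intro power_mono norm_sum) simp
  also have "\<dots> \<le> (\<Sum>m=1..M. (norm (sgrad p (x m)))\<^sup>2) * real M"
    using sum_squared_le_sum_of_squares[of "\<lambda>m. norm (sgrad p (x m))" "{1..M}"] by simp
  also have "\<dots> \<le> (\<Sum>m=1..M. 4 * loss p (x m) * K) * real M"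
  proof (intro mult_right_mono sum_mono)
    fix m assume "m \<in> {1..M}"
    then have "4 * loss p (x m) * (lipc T (x m))\<^sup>2 \<le> 4 * loss p (x m) * K"
      by (intro mult_left_mono x) (auto simp: loss_nonneg)
    with norm_sgrad_le[OF p, of "x m"] show "(norm (sgrad p (x m)))\<^sup>2 \<le> 4 * loss p (x m) * K"
      by (rule order_trans)
  qed simp
  finally have "(norm (\<Sum>m=1..M. sgrad p (x m)))\<^sup>2 \<le> 4 * K * (\<Sum>m=1..M. loss p (x m)) * real M"
    by (simp add: sum_distrib_left sum_distrib_right mult_ac)
  then show ?thesis using M by (simp add: bgrad_def bloss_def field_simps power2_eq_square)
qed

lemma lipc_sq: "0 \<le> T \<Longrightarrow> (lipc T x)\<^sup>2 = (real L)\<^sup>2 * (1 + T) ^ (L - 1) * (1 + (vnorm (l 0) x)\<^sup>2)"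
proof -
  assume "0 \<le> T"
  then have "(sqrt (1 + T) ^ (L - 1))\<^sup>2 = (1 + T) ^ (L - 1)"
    by (simp add: power_mult[symmetric] mult.commute[of _ 2] power_mult)
  then show ?thesis by (simp add: lipc_def power_mult_distrib)
qed

text \<open>\<open>rad A s\<close> bounds the squared norm on the sublevel set of \<open>lyap\<close> through a point of norm \<open>s - 1\<close>,
  and \<open>lipc2 A s\<close> bounds \<open>lipc\<^sup>2\<close> there.\<close>
definition rad :: "real \<Rightarrow> real \<Rightarrow> real" where
  "rad A s = 9 * real L * A\<^sup>2 * s\<^sup>2 - 1"

text \<open>Comparability of \<open>lyap\<close> with the squared distance from
  \<open>center\<close> gives |p - center| \<le> sqrt L |p0 - center|, and \<open>center\<close> has
  norm at most \<open>A\<close>.\<close>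

lemma norm_sq_le_rad:
  assumes p: "lyap p \<le> lyap p0" and A: "vnorm (l L) \<xi> \<le> A" "1 \<le> A"
  shows "(norm p)\<^sup>2 \<le> rad A (norm p0 + 1)"
proof -
  let ?s = "norm p0 + 1" and ?r = "sqrt (real L)"
  have r: "1 \<le> ?r" "?r\<^sup>2 = real L" using L_pos by auto
  have "(norm (p - center))\<^sup>2 \<le> real L * (norm (p0 - center))\<^sup>2"
    using lyap_ge[of p] p lyap_le[of p0] by linarith
  also have "\<dots> = (?r * norm (p0 - center))\<^sup>2" by (simp add: power_mult_distrib r)
  finally have "norm (p - center) \<le> ?r * norm (p0 - center)"
    by (rule power2_le_imp_le) simp
  also have "\<dots> \<le> ?r * (norm p0 + A)"
    using norm_triangle_ineq4[of p0 center] A norm_center by (intro mult_left_mono) auto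
  finally have "norm p \<le> A + ?r * (norm p0 + A)"
    using norm_triangle_ineq2[of p center] A norm_center by linarith
  \<comment> \<open>The constants 1, \<open>A\<close> and \<open>?r * A\<close> are each at most
    \<open>?r * A\<close>, whence the factor 3 here and 9 in \<open>rad\<close>.\<close>
  moreover have "1 * A \<le> ?r * A" "1 * norm p0 \<le> A * norm p0" "1 * 1 \<le> ?r * A"
    using r A by (intro mult_right_mono mult_mono; simp)+
  moreover have "?r * (1 * norm p0) \<le> ?r * (A * norm p0)"
    using r A by (intro mult_left_mono mult_right_mono) auto
  moreover have "0 \<le> ?r * (A * norm p0)" using r A by simp
  ultimately have "norm p + 1 \<le> 3 * (?r * (A * ?s))"
    by (simp add: algebra_simps)
  then have "(norm p + 1)\<^sup>2 \<le> (3 * (?r * (A * ?s)))\<^sup>2"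
    by (rule power_mono) simp
  also have "\<dots> = 9 * real L * A\<^sup>2 * ?s\<^sup>2" by (simp add: power_mult_distrib r)
  finally have "(norm p + 1)\<^sup>2 \<le> 9 * real L * A\<^sup>2 * ?s\<^sup>2" .
  \<comment> \<open>The spare 1 explains the \<open>- 1\<close> in \<open>rad\<close>: it turns
    \<open>1 + rad A s\<close> into a monomial.\<close>
  moreover have "(norm p)\<^sup>2 + 1 \<le> (norm p + 1)\<^sup>2" by (simp add: power2_eq_square algebra_simps)
  ultimately show ?thesis by (simp add: rad_def)
qed

lemma rad_nonneg: "1 \<le> A \<Longrightarrow> 1 \<le> s \<Longrightarrow> 0 \<le> rad A s"
proof -
  assume "1 \<le> A" "1 \<le> s"
  then have "1 * 1 * 1 \<le> real L * A\<^sup>2 * s\<^sup>2"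
    using L_pos by (intro mult_mono) auto
  then show ?thesis by (simp add: rad_def)
qed

definition lipc2 :: "real \<Rightarrow> real \<Rightarrow> real" where
  "lipc2 A s = (real L)\<^sup>2 * (9 * real L * A\<^sup>2 * s\<^sup>2) ^ (L - 1) * (real (offs l (Suc L)) * A\<^sup>2)"

lemma lipc_sq_le:
  assumes "1 \<le> A" "1 \<le> s" "1 + (vnorm (l 0) x)\<^sup>2 \<le> real (offs l (Suc L)) * A\<^sup>2"
  shows "(lipc (rad A s) x)\<^sup>2 \<le> lipc2 A s"
  unfolding lipc_sq[OF rad_nonneg[OF assms(1,2)]] lipc2_def
  using assms by (intro mult_mono) (auto simp: rad_def)

text \<open>With \<open>Y\<close> the square of 4 L d A s, each of the \<open>L - 1\<close> repeated
  factors of \<open>lipc2\<close> is at most \<open>Y\<close> and four times the remaining factor is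
  at most \<open>2 * Y\<close>, so \<open>4 * lipc2 A s \<le> 2 * Y ^ L\<close>. The step size
  restriction says exactly \<open>t * Y ^ L \<le> 1\<close>.\<close>

lemma step_size_bound:
  assumes A: "1 \<le> A" and s: "1 \<le> s" and t: "0 \<le> t"
    and small: "(4 * real L * real (offs l (Suc L)) * A) ^ (2 * L) * t \<le> 1 / s ^ (2 * L)"
    and d: "1 \<le> offs l (Suc L)"
  shows "t * (4 * lipc2 A s) \<le> 2"
proof -
  let ?d = "real (offs l (Suc L))"
  define Y where "Y = (4 * real L * ?d * A * s)\<^sup>2"
  have d1: "1 \<le> ?d" using d by simp
  have L1: "1 \<le> real L" using L_pos by simp
  have "9 * real L * A\<^sup>2 * s\<^sup>2 \<le> 16 * ((real L)\<^sup>2 * ?d\<^sup>2) * A\<^sup>2 * s\<^sup>2"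
  proof -
    have "real L * 1 \<le> (real L)\<^sup>2 * ?d\<^sup>2"
      using self_le_power[OF L1, of 2] one_le_power[OF d1, of 2] by (intro mult_mono) auto
    then show ?thesis by (intro mult_right_mono) auto
  qed
  then have a: "(9 * real L * A\<^sup>2 * s\<^sup>2) ^ (L - 1) \<le> Y ^ (L - 1)"
    by (intro power_mono) (auto simp: Y_def power_mult_distrib)
  have "4 * ((real L)\<^sup>2 * (?d * A\<^sup>2)) * 1 \<le> 4 * ((real L)\<^sup>2 * (?d\<^sup>2 * A\<^sup>2)) * s\<^sup>2"
    using self_le_power[OF d1, of 2] one_le_power[OF s, of 2] by (intro mult_mono) auto
  moreover have "Y = 4 * (4 * ((real L)\<^sup>2 * (?d\<^sup>2 * A\<^sup>2)) * s\<^sup>2)"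
    by (simp add: Y_def power_mult_distrib mult_ac)
  moreover have "0 \<le> Y" by (simp add: Y_def)
  ultimately have "4 * ((real L)\<^sup>2 * (?d * A\<^sup>2)) \<le> 2 * Y"
    by linarith
  then have "4 * lipc2 A s \<le> 2 * Y * Y ^ (L - 1)"
    using mult_mono[OF _ a, of "4 * ((real L)\<^sup>2 * (?d * A\<^sup>2))" "2 * Y"]
    by (simp add: lipc2_def Y_def mult_ac)
  also have "\<dots> = 2 * Y ^ L" using L_pos by (cases L) auto
  finally have *: "4 * lipc2 A s \<le> 2 * Y ^ L" .
  have Yp: "Y ^ L = (4 * real L * ?d * A) ^ (2 * L) * s ^ (2 * L)"
    unfolding Y_def by (simp only: power_mult_distrib power_mult)
  from * have "t * (4 * lipc2 A s) \<le> t * (2 * Y ^ L)" using t by (rule mult_left_mono)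
  also have "\<dots> = 2 * ((4 * real L * ?d * A) ^ (2 * L) * t * s ^ (2 * L))"
    by (simp add: Yp)
  also have "\<dots> \<le> 2 * (1 / s ^ (2 * L) * s ^ (2 * L))"
    using s by (intro mult_left_mono mult_right_mono small) auto
  finally show ?thesis using s by simp
qed

text \<open>The first-order gain is 4 L t times the batch loss. By \<open>norm_bgrad_le\<close> and
  the bound on \<open>t\<close>, the second-order term costs at most 2 L t times the batch loss, so
  half of the gain survives.\<close>

lemma lyap_descent:
  assumes M: "1 \<le> M" and p: "(norm p)\<^sup>2 \<le> T" and t: "0 \<le> t" "t * (4 * K) \<le> 2"
    and x: "\<And>m. \<lbrakk>1 \<le> m; m \<le> M\<rbrakk> \<Longrightarrow> (lipc T (x m))\<^sup>2 \<le> K"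
  shows "lyap (p - t *\<^sub>R bgrad M x p) + 2 * real L * (t * bloss M x p) \<le> lyap p"
    and "(norm (t *\<^sub>R bgrad M x p))\<^sup>2 \<le> 2 * (t * bloss M x p)"
proof -
  let ?g = "bgrad M x p" and ?b = "bloss M x p"
  have "t\<^sup>2 * (norm ?g)\<^sup>2 \<le> t\<^sup>2 * (4 * K * ?b)"
    using norm_bgrad_le[of M p T x K] assms by (intro mult_left_mono) auto
  also have "\<dots> = t * (4 * K) * (t * ?b)" by (simp add: power2_eq_square)
  also have "\<dots> \<le> 2 * (t * ?b)"
    using t bloss_nonneg[of M x p] by (intro mult_right_mono) auto
  finally have g: "t\<^sup>2 * (norm ?g)\<^sup>2 \<le> 2 * (t * ?b)" .
  then show "(norm (t *\<^sub>R ?g))\<^sup>2 \<le> 2 * (t * ?b)" by (simp add: power_mult_distrib)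
  have "real L * (t\<^sup>2 * (norm ?g)\<^sup>2) \<le> real L * (2 * (t * ?b))" by (intro mult_left_mono g) simp
  with lyap_step[of p t ?g] show "lyap (p - t *\<^sub>R ?g) + 2 * real L * (t * ?b) \<le> lyap p"
    by (simp add: bgrad_inner_lyap_grad mult_ac)
qed

lemma lyap_nonneg: "0 \<le> lyap p"
  using lyap_ge[of p] zero_le_power2[of "norm (p - center)"] by linarith

text \<open>The descent estimate and the norm bound are proved hand in hand: the accumulated
  decrease keeps the iterate in the initial sublevel set, where \<open>rad\<close> and
  \<open>lipc2\<close> provide the constants for the next step.\<close>

lemma sgd_path:
  fixes p :: "nat \<Rightarrow> real^'d" and x :: "nat \<Rightarrow> nat \<Rightarrow> nat \<Rightarrow> real"
  assumes M: "\<And>n. 1 \<le> M n" and A: "1 \<le> A" "vnorm (l L) \<xi> \<le> A" and d: "1 \<le> offs l (Suc L)"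
    and x: "\<And>n m. 1 + (vnorm (l 0) (x n m))\<^sup>2 \<le> real (offs l (Suc L)) * A\<^sup>2"
    and t: "\<And>n. 0 \<le> t n"
    and small: "\<And>n. (4 * real L * real (offs l (Suc L)) * A) ^ (2 * L) * t n \<le> 1 / (norm (p 0) + 1) ^ (2 * L)"
    and rec: "\<And>n. p (Suc n) = p n - t n *\<^sub>R bgrad (M n) (x n) (p n)"
  shows "(norm (p n))\<^sup>2 \<le> rad A (norm (p 0) + 1)"
    and "(\<Sum>k<n. t k * bloss (M k) (x k) (p k)) \<le> lyap (p 0) / (2 * real L)"
    and "(norm (p (Suc n) - p n))\<^sup>2 \<le> 2 * (t n * bloss (M n) (x n) (p n))"
proof -
  let ?s = "norm (p 0) + 1"
  have K: "t n * (4 * lipc2 A ?s) \<le> 2" for n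
    by (rule step_size_bound[OF A(1) _ t small d]) simp
  have lip: "(lipc (rad A ?s) (x n m))\<^sup>2 \<le> lipc2 A ?s" for n m
    by (rule lipc_sq_le[OF A(1) _ x]) simp
  have rad: "lyap (p n) \<le> lyap (p 0) \<Longrightarrow> (norm (p n))\<^sup>2 \<le> rad A ?s" for n
    by (rule norm_sq_le_rad[OF _ A(2,1)])
  have *: "lyap (p n) + 2 * real L * (\<Sum>k<n. t k * bloss (M k) (x k) (p k)) \<le> lyap (p 0)" for n
  proof (induction n)
    case (Suc n)
    have nn: "0 \<le> 2 * real L * (\<Sum>k<n. t k * bloss (M k) (x k) (p k))"
      by (intro mult_nonneg_nonneg sum_nonneg t bloss_nonneg) auto
    with Suc have "(norm (p n))\<^sup>2 \<le> rad A ?s" by (intro rad) linarith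
    from lyap_descent(1)[where x = "x n", OF M[of n] this t[of n] K lip] Suc show ?case
      by (simp add: rec algebra_simps)
  qed simp
  have "0 \<le> 2 * real L * (\<Sum>k<n. t k * bloss (M k) (x k) (p k))" for n
    by (intro mult_nonneg_nonneg sum_nonneg t bloss_nonneg) auto
  with * have "lyap (p n) \<le> lyap (p 0)" for n
    using add_le_imp_le_right by (smt (verit))
  then show r: "(norm (p n))\<^sup>2 \<le> rad A ?s" for n by (rule rad)
  show "(\<Sum>k<n. t k * bloss (M k) (x k) (p k)) \<le> lyap (p 0) / (2 * real L)"
    using *[of n] lyap_nonneg[of "p n"] L_pos by (simp add: field_simps)
  show "(norm (p (Suc n) - p n))\<^sup>2 \<le> 2 * (t n * bloss (M n) (x n) (p n))"
    using lyap_descent(2)[where x = "x n", OF M[of n] r[of n] t[of n] K lip] by (simp add: rec)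
qed

end

section \<open>Independence and measurability\<close>

text \<open>Adjoins one more family, at index \<open>None\<close>, to an independent family.
  Splitting \<open>None\<close> off a finite index set reduces the product formula to
  \<open>ZE\<close> and the independence of \<open>E\<close>.\<close>

lemma (in prob_space) indep_sets_option:
  assumes E: "indep_sets E UNIV" and Z: "Z \<subseteq> events"
    and ZE: "\<And>z J A. \<lbrakk>z \<in> Z; finite J; J \<noteq> {}; \<forall>j\<in>J. A j \<in> E j\<rbrakk> \<Longrightarrow>
      prob (z \<inter> (\<Inter>j\<in>J. A j)) = prob z * prob (\<Inter>j\<in>J. A j)"
  shows "indep_sets (case_option Z E) UNIV"
proof (rule indep_setsI)
  fix j show "case_option Z E j \<subseteq> events"
    using E Z by (auto split: option.split simp: indep_sets_def)
next
  fix A J assume J: "J \<noteq> {}" "finite J" and A: "\<forall>j\<in>J. A j \<in> case_option Z E j"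
  define K where "K = Some -` J"
  let ?B = "\<lambda>k. A (Some k)"
  have K: "finite K" unfolding K_def using J by (intro finite_vimageI) auto
  have BE: "\<forall>k\<in>K. ?B k \<in> E k" using A by (force simp: K_def)
  have KS: "prob (\<Inter>k\<in>K. ?B k) = (\<Prod>k\<in>K. prob (?B k))" if "K \<noteq> {}"
    using indep_setsD[OF E, of K ?B] K that BE by auto
  have im: "J - {None} = Some ` K"
    by (auto simp: image_iff K_def)
  have IK: "(\<Inter>j\<in>J - {None}. A j) = (\<Inter>k\<in>K. ?B k)"
    "(\<Prod>j\<in>J - {None}. prob (A j)) = (\<Prod>k\<in>K. prob (?B k))"
    unfolding im by (simp_all add: prod.reindex image_image)
  show "prob (\<Inter>j\<in>J. A j) = (\<Prod>j\<in>J. prob (A j))"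
  proof (cases "None \<in> J")
    case True
    then have J': "J = insert None (J - {None})" by auto
    have z: "A None \<in> Z" using A True by force
    have "(\<Inter>j\<in>J. A j) = A None \<inter> (\<Inter>k\<in>K. ?B k)"
      by (subst J') (simp only: INF_insert IK)
    moreover have "(\<Prod>j\<in>J. prob (A j)) = prob (A None) * (\<Prod>k\<in>K. prob (?B k))"
      using prod.remove[OF J(2) True, of "\<lambda>j. prob (A j)"] IK by simp
    moreover have "prob (A None \<inter> (\<Inter>k\<in>K. ?B k)) = prob (A None) * prob (\<Inter>k\<in>K. ?B k)" if "K \<noteq> {}"
      using ZE[OF z K that BE] .
    ultimately show ?thesis using KS by (cases "K = {}") auto
  next
    case False
    then have J': "J = J - {None}" by auto
    then have "K \<noteq> {}" using im J(1) by auto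
    then show ?thesis using KS IK J' by simp
  qed
qed

lemma Int_stable_vimage: "Int_stable {f -` B \<inter> \<Omega> | B. B \<in> sets N}"
proof (rule Int_stableI)
  fix a b assume "a \<in> {f -` B \<inter> \<Omega> | B. B \<in> sets N}" "b \<in> {f -` B \<inter> \<Omega> | B. B \<in> sets N}"
  then obtain B C where "B \<in> sets N" "C \<in> sets N" "a = f -` B \<inter> \<Omega>" "b = f -` C \<inter> \<Omega>" by auto
  then show "a \<inter> b \<in> {f -` B \<inter> \<Omega> | B. B \<in> sets N}"
    by (intro CollectI exI[of _ "B \<inter> C"]) auto
qed

text \<open>Grouping intersection-stable independent generators into the blocks \<open>J\<close> and
  \<open>{i}\<close> makes the two generated sigma-algebras independent, and \<open>Y\<close> and
  \<open>X\<close> are measurable with respect to one each.\<close>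

lemma (in prob_space) distr_pair_of_indep_sigma:
  assumes E: "indep_sets E UNIV" and stable: "\<And>i. Int_stable (E i)"
    and i: "i \<notin> J" "E i = {X -` A \<inter> space M | A. A \<in> sets N}" and X[measurable]: "X \<in> measurable M N"
    and Y: "Y \<in> measurable (sigma (space M) (\<Union>j\<in>J. E j)) T" and YM[measurable]: "Y \<in> measurable M T"
  shows "distr M T Y \<Otimes>\<^sub>M distr M N X = distr M (T \<Otimes>\<^sub>M N) (\<lambda>\<omega>. (Y \<omega>, X \<omega>))"
proof (rule pair_measure_eqI)
  interpret DY: prob_space "distr M T Y" by (rule prob_space_distr) fact
  interpret DX: prob_space "distr M N X" by (rule prob_space_distr) fact
  show "sigma_finite_measure (distr M T Y)" "sigma_finite_measure (distr M N X)" ..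
  show "sets (distr M T Y \<Otimes>\<^sub>M distr M N X) = sets (distr M (T \<Otimes>\<^sub>M N) (\<lambda>\<omega>. (Y \<omega>, X \<omega>)))"
    by (simp cong: sets_pair_measure_cong)
  fix A B assume A: "A \<in> sets (distr M T Y)" and B: "B \<in> sets (distr M N X)"
  have "indep_sets (\<lambda>b. sigma_sets (space M) (\<Union>j\<in>case_bool J {i} b. E j)) UNIV"
    by (rule indep_sets_collect_sigma[OF indep_sets_mono_index[OF _ E] stable])
      (use i in \<open>auto simp: disjoint_family_on_def split: bool.split\<close>)
  then have ind: "indep_set (sigma_sets (space M) (\<Union>j\<in>J. E j)) (sigma_sets (space M) (E i))"
    unfolding indep_set_def by (rule indep_sets_mono_sets) (auto split: bool.split)
  have "E j \<subseteq> events" for j using E by (auto simp: indep_sets_def)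
  then have pow: "(\<Union>j\<in>J. E j) \<subseteq> Pow (space M)" using sets.space_closed by blast
  have "Y -` A \<inter> space M \<in> sigma_sets (space M) (\<Union>j\<in>J. E j)"
    using measurable_sets[OF Y, of A] A pow by (simp add: space_measure_of sets_measure_of)
  moreover have "X -` B \<inter> space M \<in> sigma_sets (space M) (E i)"
    using B i(2) by (intro sigma_sets.Basic) auto
  ultimately have "prob ((Y -` A \<inter> space M) \<inter> (X -` B \<inter> space M)) = prob (Y -` A \<inter> space M) * prob (X -` B \<inter> space M)"
    by (rule indep_setD[OF ind])
  moreover have "(Y -` A \<inter> space M) \<inter> (X -` B \<inter> space M) = (\<lambda>\<omega>. (Y \<omega>, X \<omega>)) -` (A \<times> B) \<inter> space M"
    by auto
  ultimately show "emeasure (distr M T Y) A * emeasure (distr M N X) B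
    = emeasure (distr M (T \<Otimes>\<^sub>M N) (\<lambda>\<omega>. (Y \<omega>, X \<omega>))) (A \<times> B)"
    using A B by (simp add: emeasure_distr emeasure_eq_measure ennreal_mult)
qed

text \<open>Freezing: as the joint law is a product, Tonelli replaces \<open>X\<close> by an
  independent copy while \<open>Y\<close> is held fixed.\<close>

lemma (in prob_space) nn_integral_distr_pair:
  assumes [measurable]: "Y \<in> measurable M S" "X \<in> measurable M N"
    and ind: "distr M S Y \<Otimes>\<^sub>M distr M N X = distr M (S \<Otimes>\<^sub>M N) (\<lambda>\<omega>. (Y \<omega>, X \<omega>))"
    and f: "f \<in> borel_measurable (S \<Otimes>\<^sub>M N)"
  shows "(\<integral>\<^sup>+\<omega>. f (Y \<omega>, X \<omega>) \<partial>M) = (\<integral>\<^sup>+\<omega>. (\<integral>\<^sup>+x. f (Y \<omega>, x) \<partial>distr M N X) \<partial>M)"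
proof -
  interpret DX: prob_space "distr M N X" by (rule prob_space_distr) fact
  have f': "f \<in> borel_measurable (S \<Otimes>\<^sub>M distr M N X)" "f \<in> borel_measurable (distr M S Y \<Otimes>\<^sub>M distr M N X)"
    using f by (simp_all cong: measurable_cong_sets sets_pair_measure_cong)
  have "(\<integral>\<^sup>+\<omega>. f (Y \<omega>, X \<omega>) \<partial>M) = (\<integral>\<^sup>+z. f z \<partial>(distr M S Y \<Otimes>\<^sub>M distr M N X))"
    unfolding ind using f by (subst nn_integral_distr) auto
  also have "\<dots> = (\<integral>\<^sup>+y. (\<integral>\<^sup>+x. f (y, x) \<partial>distr M N X) \<partial>distr M S Y)"
    by (rule DX.nn_integral_fst[symmetric]) (rule f')
  also have "\<dots> = (\<integral>\<^sup>+\<omega>. (\<integral>\<^sup>+x. f (Y \<omega>, x) \<partial>distr M N X) \<partial>M)"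
    using DX.borel_measurable_nn_integral_fst[OF f'(1)]
    by (subst nn_integral_distr) auto
  finally show ?thesis .
qed

text \<open>By monotone convergence the series has finite expectation, hence it is finite almost
  everywhere.\<close>

lemma AE_summable_of_expectation:
  fixes u :: "nat \<Rightarrow> 'a \<Rightarrow> real"
  assumes u[measurable]: "\<And>k. u k \<in> borel_measurable M" and u0: "\<And>k \<omega>. 0 \<le> u k \<omega>"
    and fin: "(\<Sum>k. \<integral>\<^sup>+\<omega>. ennreal (u k \<omega>) \<partial>M) < \<infinity>"
  shows "AE \<omega> in M. summable (\<lambda>k. u k \<omega>)"
proof -
  have "(\<integral>\<^sup>+\<omega>. (\<Sum>k. ennreal (u k \<omega>)) \<partial>M) \<noteq> \<infinity>"
    using fin by (subst nn_integral_suminf) auto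
  then have "AE \<omega> in M. (\<Sum>k. ennreal (u k \<omega>)) \<noteq> \<infinity>"
    by (intro nn_integral_PInf_AE) auto
  then show ?thesis
    by eventually_elim (use u0 in \<open>auto intro: summable_suminf_not_top\<close>)
qed

section \<open>Measurability in the parameters and the data\<close>

lemma relu_measurable: "g \<in> borel_measurable N \<Longrightarrow> (\<lambda>\<omega>. relu k (g \<omega>)) \<in> borel_measurable N"
  unfolding relu_def by measurable

lemma heaviside_measurable: "g \<in> borel_measurable N \<Longrightarrow> (\<lambda>\<omega>. heaviside k (g \<omega>)) \<in> borel_measurable N"
  unfolding heaviside_def by measurable

lemma affine_measurable:
  assumes "\<And>q. (\<lambda>\<omega>. \<theta> \<omega> q) \<in> borel_measurable N"
    and "\<And>j. \<lbrakk>1 \<le> j; j \<le> l (k-1)\<rbrakk> \<Longrightarrow> (\<lambda>\<omega>. v \<omega> j) \<in> borel_measurable N"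
  shows "(\<lambda>\<omega>. affine l (\<theta> \<omega>) k (v \<omega>) i) \<in> borel_measurable N"
  unfolding affine_def bias_def wgt_def using assms
  by (intro borel_measurable_add borel_measurable_sum borel_measurable_times) auto

text \<open>Stated from layer 1 on: the realization at 0 is the input, whose coordinates are assumed
  measurable only between 1 and \<open>l 0\<close>.\<close>

lemma realiz_measurable:
  assumes \<theta>: "\<And>q. (\<lambda>\<omega>. \<theta> \<omega> q) \<in> borel_measurable N"
    and x: "\<And>j. \<lbrakk>1 \<le> j; j \<le> l 0\<rbrakk> \<Longrightarrow> (\<lambda>\<omega>. x \<omega> j) \<in> borel_measurable N"
  shows "(\<lambda>\<omega>. realiz l relu (\<theta> \<omega>) (Suc k) (x \<omega>) i) \<in> borel_measurable N"
proof (induction k arbitrary: i)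
  case 0
  show ?case unfolding realiz_Suc hid_def by (intro affine_measurable) (use assms in auto)
next
  case (Suc k)
  then have "(\<lambda>\<omega>. hid l relu (\<theta> \<omega>) (Suc k) (x \<omega>) j) \<in> borel_measurable N" for j
    by (simp add: hid_def relu_measurable)
  then show ?case
    by (subst realiz_Suc) (intro affine_measurable \<theta>)
qed

lemma hid_measurable:
  assumes \<theta>: "\<And>q. (\<lambda>\<omega>. \<theta> \<omega> q) \<in> borel_measurable N"
    and x: "\<And>j. \<lbrakk>1 \<le> j; j \<le> l 0\<rbrakk> \<Longrightarrow> (\<lambda>\<omega>. x \<omega> j) \<in> borel_measurable N"
    and j: "1 \<le> j" "j \<le> l k"
  shows "(\<lambda>\<omega>. hid l relu (\<theta> \<omega>) k (x \<omega>) j) \<in> borel_measurable N"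
proof (cases k)
  case 0
  then show ?thesis using x j by (simp add: hid_def)
next
  case (Suc k')
  have "(\<lambda>\<omega>. realiz l relu (\<theta> \<omega>) (Suc k') (x \<omega>) j) \<in> borel_measurable N"
    by (rule realiz_measurable[OF \<theta> x])
  then show ?thesis using Suc by (simp add: hid_def relu_measurable)
qed

lemma drealiz_measurable:
  assumes \<theta>: "\<And>q. (\<lambda>\<omega>. \<theta> \<omega> q) \<in> borel_measurable N"
    and x: "\<And>j. \<lbrakk>1 \<le> j; j \<le> l 0\<rbrakk> \<Longrightarrow> (\<lambda>\<omega>. x \<omega> j) \<in> borel_measurable N"
  shows "(\<lambda>\<omega>. drealiz l relu heaviside (\<theta> \<omega>) \<eta> k (x \<omega>) i) \<in> borel_measurable N"
proof (induction k arbitrary: i)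
  case (Suc k)
  have "(\<lambda>\<omega>. heaviside k (realiz l relu (\<theta> \<omega>) k (x \<omega>) j) * drealiz l relu heaviside (\<theta> \<omega>) \<eta> k (x \<omega>) j) \<in> borel_measurable N" for j
  proof (cases k)
    case (Suc k')
    have "(\<lambda>\<omega>. realiz l relu (\<theta> \<omega>) k (x \<omega>) j) \<in> borel_measurable N"
      unfolding Suc by (rule realiz_measurable[OF \<theta> x])
    then show ?thesis by (intro borel_measurable_times heaviside_measurable Suc.IH)
  qed simp
  then have "(\<lambda>\<omega>. lin l (\<theta> \<omega>) (Suc k) (\<lambda>j. heaviside k (realiz l relu (\<theta> \<omega>) k (x \<omega>) j)
      * drealiz l relu heaviside (\<theta> \<omega>) \<eta> k (x \<omega>) j) i) \<in> borel_measurable N"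
    unfolding lin_def wgt_def by (rule borel_measurable_sum[OF borel_measurable_times[OF \<theta>]])
  moreover have "(\<lambda>\<omega>. affine l \<eta> (Suc k) (hid l relu (\<theta> \<omega>) k (x \<omega>)) i) \<in> borel_measurable N"
    by (intro affine_measurable) (auto intro: hid_measurable[OF \<theta> x])
  ultimately show ?case by simp
qed simp

context network begin

context
  fixes f :: "'w \<Rightarrow> real^'d" and x :: "'w \<Rightarrow> nat \<Rightarrow> real" and N :: "'w measure"
  assumes f: "f \<in> borel_measurable N"
    and x: "\<And>j. \<lbrakk>1 \<le> j; j \<le> l 0\<rbrakk> \<Longrightarrow> (\<lambda>\<omega>. x \<omega> j) \<in> borel_measurable N"
begin

lemma params_measurable: "(\<lambda>\<omega>. f \<omega> $ e q) \<in> borel_measurable N"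
  using borel_measurable_continuous_on[OF _ f, of "\<lambda>v. v $ e q"] by (simp add: continuous_on_component)

lemma realiz_params_measurable: "(\<lambda>\<omega>. realiz l relu (params (f \<omega>)) L (x \<omega>) i) \<in> borel_measurable N"
  using realiz_measurable[of "\<lambda>\<omega>. params (f \<omega>)" N l x "L - 1" i] params_measurable x L_pos by simp

lemma loss_measurable: "(\<lambda>\<omega>. loss (f \<omega>) (x \<omega>)) \<in> borel_measurable N"
  unfolding sqloss_def vnorm_sq
  by (intro borel_measurable_sum borel_measurable_power borel_measurable_diff realiz_params_measurable) simp

lemma sgrad_measurable: "(\<lambda>\<omega>. sgrad (f \<omega>) (x \<omega>)) \<in> borel_measurable N"
proof (subst borel_measurable_euclidean_space, rule ballI)
  fix h :: "real^'d"
  have "(\<lambda>\<omega>. drealiz l relu heaviside (params (f \<omega>)) (params h) L (x \<omega>) i) \<in> borel_measurable N" for i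
    by (rule drealiz_measurable) (use params_measurable x in auto)
  then show "(\<lambda>\<omega>. sgrad (f \<omega>) (x \<omega>) \<bullet> h) \<in> borel_measurable N"
    unfolding inner_rgrad
    by (intro borel_measurable_sum borel_measurable_times borel_measurable_diff realiz_params_measurable) simp_all
qed

end

lemma bgrad_measurable:
  assumes "f \<in> borel_measurable N"
    and "\<And>m j. \<lbrakk>1 \<le> j; j \<le> l 0\<rbrakk> \<Longrightarrow> (\<lambda>\<omega>. x m \<omega> j) \<in> borel_measurable N"
  shows "(\<lambda>\<omega>. bgrad k (\<lambda>m. x m \<omega>) (f \<omega>)) \<in> borel_measurable N"
  unfolding bgrad_def
  by (intro borel_measurable_scaleR borel_measurable_sum sgrad_measurable[OF assms]) simp_all

lemma bloss_measurable:
  assumes "f \<in> borel_measurable N"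
    and "\<And>m j. \<lbrakk>1 \<le> j; j \<le> l 0\<rbrakk> \<Longrightarrow> (\<lambda>\<omega>. x m \<omega> j) \<in> borel_measurable N"
  shows "(\<lambda>\<omega>. bloss k (\<lambda>m. x m \<omega>) (f \<omega>)) \<in> borel_measurable N"
  unfolding bloss_def
  by (intro borel_measurable_times borel_measurable_sum loss_measurable[OF assms]) simp_all

end

section \<open>The limit of the smoothed batch gradients\<close>

locale smooth_network = network l L \<xi> e + smooth_relu Rf
  for l :: "nat \<Rightarrow> nat" and L \<xi> and e :: "nat \<Rightarrow> 'd::finite" and Rf
begin

text \<open>For \<open>r \<ge> 1\<close> the smoothed loss is differentiable and \<open>grad\<close>
  is the explicit mean of the \<open>rgrad\<close>, which converges sample by sample.\<close>

lemma grad_batch_tendsto: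
  "((\<lambda>r. grad (\<lambda>p. (1 / real M) * (\<Sum>m=1..M. sqloss l L \<xi> (act r) (params p) (x m))) p)
    \<longlongrightarrow> bgrad M x p) at_top"
proof -
  let ?g = "\<lambda>r. (1 / real M) *\<^sub>R (\<Sum>m=1..M. rgrad l L \<xi> (act r) (act' r) e p (x m))"
  have "(?g \<longlongrightarrow> bgrad M x p) at_top"
    unfolding bgrad_def by (intro tendsto_intros rgrad_tendsto)
  moreover have "\<forall>\<^sub>F r in at_top.
    ?g r = grad (\<lambda>p. (1 / real M) * (\<Sum>m=1..M. sqloss l L \<xi> (act r) (params p) (x m))) p"
    using eventually_ge_at_top[of 1]
  proof eventually_elim
    case (elim r)
    have "((\<lambda>p. sqloss l L \<xi> (act r) (params p) (x m)) has_derivative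
      (\<lambda>h. h \<bullet> rgrad l L \<xi> (act r) (act' r) e p (x m))) (at p)" for m
      using sqloss_GDERIV[of "act r" "act' r" l L \<xi> e "x m" p] act_has_derivative[OF elim]
      by (simp add: gderiv_def)
    then have "GDERIV (\<lambda>p. (1 / real M) * (\<Sum>m=1..M. sqloss l L \<xi> (act r) (params p) (x m))) p :> ?g r"
      unfolding gderiv_def inner_scaleR_right inner_sum_right
      by (intro has_derivative_mult_right has_derivative_sum)
    then show ?case by (rule grad_eqI[symmetric])
  qed
  ultimately show ?thesis by (rule Lim_transform_eventually)
qed

end

section \<open>The stochastic gradient process and its past\<close>

locale sgd = network l L \<xi> e + prob_space M
  for l :: "nat \<Rightarrow> nat" and L \<xi> and e :: "nat \<Rightarrow> 'd::finite" and M :: "'w measure" +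
  fixes X :: "nat \<Rightarrow> nat \<Rightarrow> 'w \<Rightarrow> (nat \<Rightarrow> real)" and Ms :: "nat \<Rightarrow> nat"
    and \<Theta> :: "nat \<Rightarrow> 'w \<Rightarrow> real^'d" and \<gamma> :: "nat \<Rightarrow> real" and A S :: real
  assumes A: "1 \<le> A" "vnorm (l L) \<xi> \<le> A" and d: "1 \<le> offs l (Suc L)"
    and X_meas: "\<And>n m. X n m \<in> measurable M (PiM {1..l 0} (\<lambda>_. borel))"
    and X_bound: "\<And>n m \<omega>. \<omega> \<in> space M \<Longrightarrow> 1 + (vnorm (l 0) (X n m \<omega>))\<^sup>2 \<le> real (offs l (Suc L)) * A\<^sup>2"
    and X_indep: "indep_vars (\<lambda>_. PiM {1..l 0} (\<lambda>_. borel)) (\<lambda>(n, m). X n m) UNIV"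
    and X_id: "\<And>n m. distr M (PiM {1..l 0} (\<lambda>_. borel)) (X n m) = distr M (PiM {1..l 0} (\<lambda>_. borel)) (X 0 0)"
    and Ms_pos: "\<And>n. 1 \<le> Ms n"
    and \<Theta>_meas: "\<And>n. \<Theta> n \<in> borel_measurable M"
    and \<Theta>_indep: "indep_set {\<Theta> 0 -` B \<inter> space M | B. B \<in> sets borel}
        {(\<lambda>\<omega> (n, m). X n m \<omega>) -` B \<inter> space M | B.
           B \<in> sets (PiM (UNIV :: (nat \<times> nat) set) (\<lambda>_. PiM {1..l 0} (\<lambda>_. borel)))}"
    and \<gamma>_nonneg: "\<And>n. 0 \<le> \<gamma> n"
    and \<gamma>_small: "\<And>n \<omega>. \<omega> \<in> space M \<Longrightarrow> (4 * real L * real (offs l (Suc L)) * A) ^ (2 * L) * \<gamma> n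
      \<le> 1 / (norm (\<Theta> 0 \<omega>) + 1) ^ (2 * L)"
    and \<gamma>_div: "\<not> summable \<gamma>"
    and \<Theta>_rec: "\<And>n \<omega>. \<omega> \<in> space M \<Longrightarrow> \<Theta> (Suc n) \<omega> = \<Theta> n \<omega> - \<gamma> n *\<^sub>R bgrad (Ms n) (\<lambda>m. X n m \<omega>) (\<Theta> n \<omega>)"
    and S: "\<And>\<omega>. \<omega> \<in> space M \<Longrightarrow> norm (\<Theta> 0 \<omega>) + 1 \<le> S"
begin

abbreviation DS :: "(nat \<Rightarrow> real) measure" where "DS \<equiv> PiM {1..l 0} (\<lambda>_. borel)"

definition risk :: "real^'d \<Rightarrow> real" where
  "risk p = expectation (\<lambda>\<omega>. loss p (X 0 0 \<omega>))"

lemma X_coord: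
  assumes "1 \<le> j" "j \<le> l 0" and "Z \<in> measurable N DS"
  shows "(\<lambda>\<omega>. Z \<omega> j) \<in> borel_measurable N"
  using measurable_compose[OF assms(3) measurable_component_singleton[of j "{1..l 0}"]] assms by simp

text \<open>The index \<open>None\<close> stands for the initial value and \<open>Some (n, m)\<close> for the sample \<open>X n m\<close>.\<close>
definition gens :: "(nat \<times> nat) option \<Rightarrow> 'w set set" where
  "gens = case_option {\<Theta> 0 -` B \<inter> space M | B. B \<in> sets borel}
     (\<lambda>(n, m). {X n m -` B \<inter> space M | B. B \<in> sets DS})"

lemma gens_indep: "indep_sets gens UNIV"
  unfolding gens_def
proof (rule indep_sets_option)
  show E: "indep_sets (\<lambda>(n, m). {X n m -` B \<inter> space M | B. B \<in> sets DS}) UNIV"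
  proof -
    have "(\<lambda>(n, m). {X n m -` B \<inter> space M | B. B \<in> sets DS})
      = (\<lambda>i. {(case i of (n, m) \<Rightarrow> X n m) -` B \<inter> space M | B. B \<in> sets DS})"
      by (auto simp: fun_eq_iff)
    then show ?thesis using X_indep unfolding indep_vars_def2 by simp
  qed
  show "{\<Theta> 0 -` B \<inter> space M | B. B \<in> sets borel} \<subseteq> events"
    using measurable_sets[OF \<Theta>_meas[of 0]] by auto
  fix z J H
  assume z: "z \<in> {\<Theta> 0 -` B \<inter> space M | B. B \<in> sets borel}" and J: "finite J" "J \<noteq> {}"
    and H: "\<forall>j\<in>J. H j \<in> (case j of (n, m) \<Rightarrow> {X n m -` B \<inter> space M | B. B \<in> sets DS})"
  have "\<forall>j\<in>J. \<exists>B. B \<in> sets DS \<and> H j = X (fst j) (snd j) -` B \<inter> space M"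
    using H by (auto simp: split_beta)
  then obtain B where B: "\<And>j. j \<in> J \<Longrightarrow> B j \<in> sets DS"
      "\<And>j. j \<in> J \<Longrightarrow> H j = X (fst j) (snd j) -` B j \<inter> space M"
    by metis
  let ?P = "PiM (UNIV :: (nat \<times> nat) set) (\<lambda>_. DS)"
  \<comment> \<open>A finite intersection of sample events is the preimage of this cylinder set
    under the joint map of all samples, to which \<open>\<Theta>_indep\<close> applies.\<close>
  let ?C = "\<Inter>j\<in>J. (\<lambda>x. x j) -` B j \<inter> space ?P"
  have "?C \<in> sets ?P"
    using J B(1) by (intro sets.finite_INT measurable_sets[OF measurable_component_singleton]) auto
  moreover have "(\<Inter>j\<in>J. H j) = (\<lambda>\<omega> (n, m). X n m \<omega>) -` ?C \<inter> space M"
  proof -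
    have "(\<lambda>(n, m). X n m \<omega>) \<in> space ?P" if "\<omega> \<in> space M" for \<omega>
      unfolding space_PiM[of UNIV] using measurable_space[OF X_meas that] by (auto simp: PiE_iff)
    then show ?thesis using J(2) B(2) by (auto simp: split_beta)
  qed
  ultimately show "prob (z \<inter> (\<Inter>j\<in>J. H j)) = prob z * prob (\<Inter>j\<in>J. H j)"
    by (intro indep_setD[OF \<Theta>_indep z]) blast
qed

lemma gens_Int_stable: "Int_stable (gens i)"
  by (auto simp: gens_def Int_stable_vimage simp del: One_nat_def split: option.split)

text \<open>The natural filtration: everything generated by the initial value and the batches before
  step \<open>n\<close>.\<close>

definition past :: "nat \<Rightarrow> 'w measure" where
  "past n = sigma (space M) (\<Union>i\<in>insert None (Some ` {(k, m). k < n}). gens i)"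

lemma space_past: "space (past n) = space M"
  and sets_past: "sets (past n) = sigma_sets (space M) (\<Union>i\<in>insert None (Some ` {(k, m). k < n}). gens i)"
proof -
  have "gens i \<subseteq> events" for i using gens_indep by (auto simp: indep_sets_def)
  then have pow: "(\<Union>i\<in>insert None (Some ` {(k, m). k < n}). gens i) \<subseteq> Pow (space M)"
    using sets.space_closed by blast
  show "space (past n) = space M" unfolding past_def by (rule space_measure_of[OF pow])
  show "sets (past n) = sigma_sets (space M) (\<Union>i\<in>insert None (Some ` {(k, m). k < n}). gens i)"
    unfolding past_def by (rule sets_measure_of[OF pow])
qed

lemma measurable_past:
  assumes gens: "gens i = {f -` B \<inter> space M | B. B \<in> sets N}"
    and i: "i \<in> insert None (Some ` {(k, m). k < n})" and f: "f \<in> measurable M N"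
  shows "f \<in> measurable (past n) N"
proof (rule measurableI)
  show "f \<omega> \<in> space N" if "\<omega> \<in> space (past n)" for \<omega>
    using measurable_space[OF f] that by (simp add: space_past)
  show "f -` B \<inter> space (past n) \<in> sets (past n)" if "B \<in> sets N" for B
    unfolding space_past sets_past by (intro sigma_sets.Basic UN_I[OF i]) (use gens that in auto)
qed

text \<open>The process is adapted, since each iterate is a measurable function of the previous one
  and of the batch just used.\<close>

lemma \<Theta>_past: "n \<le> N \<Longrightarrow> \<Theta> n \<in> borel_measurable (past N)"
proof (induction n)
  case 0
  show ?case by (rule measurable_past[of None]) (auto simp: gens_def \<Theta>_meas)
next
  case (Suc n)
  have X: "X n m \<in> measurable (past N) DS" for m
    by (rule measurable_past[of "Some (n, m)"]) (use Suc.prems X_meas in \<open>auto simp: gens_def simp del: One_nat_def\<close>)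
  have "(\<lambda>\<omega>. \<Theta> n \<omega> - \<gamma> n *\<^sub>R bgrad (Ms n) (\<lambda>m. X n m \<omega>) (\<Theta> n \<omega>)) \<in> borel_measurable (past N)"
    using Suc by (intro borel_measurable_diff borel_measurable_scaleR bgrad_measurable X_coord[OF _ _ X]) auto
  then show ?case
    by (rule measurable_cong[THEN iffD2, rotated]) (simp add: space_past \<Theta>_rec)
qed

text \<open>The iterate \<open>\<Theta> n\<close> depends only on batches before \<open>n\<close>,
  so it is independent of the samples of batch \<open>n\<close>.\<close>

lemma \<Theta>_X_distr:
  "distr M borel (\<Theta> n) \<Otimes>\<^sub>M distr M DS (X n m) = distr M (borel \<Otimes>\<^sub>M DS) (\<lambda>\<omega>. (\<Theta> n \<omega>, X n m \<omega>))"
proof (rule distr_pair_of_indep_sigma[OF gens_indep gens_Int_stable])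
  show "Some (n, m) \<notin> insert None (Some ` {(k, m). k < n})" by auto
  show "\<Theta> n \<in> measurable (sigma (space M) (\<Union>i\<in>insert None (Some ` {(k, m). k < n}). gens i)) borel"
    using \<Theta>_past[of n n] by (simp add: past_def)
qed (auto simp: gens_def X_meas \<Theta>_meas simp del: One_nat_def)

end

section \<open>Convergence of the risk\<close>

context sgd begin

text \<open>Constants uniform in \<omega> and n: \<open>T\<close> bounds the squared norm of the
  iterates, \<open>\<kappa>\<close> the local Lipschitz constant of the network, \<open>B\<close>
  the loss; \<open>\<Lambda>\<close> is a Lipschitz constant of the risk.\<close>

definition T :: real where "T = rad A S"
definition \<kappa> :: real where "\<kappa> = sqrt (lipc2 A S)"
definition B :: real where "B = (\<kappa> * sqrt T + A)\<^sup>2"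
definition \<Lambda> :: real where "\<Lambda> = 2 * \<kappa> * (\<kappa> * sqrt T + A)"

lemma S_ge: "1 \<le> S"
proof -
  obtain \<omega> where "\<omega> \<in> space M" using not_empty by blast
  from S[OF this] show ?thesis using norm_ge_zero[of "\<Theta> 0 \<omega>"] by linarith
qed

lemma T_nonneg: "0 \<le> T"
  unfolding T_def using rad_nonneg A S_ge by blast

lemma lipc_le: "\<omega> \<in> space M \<Longrightarrow> lipc T (X n m \<omega>) \<le> \<kappa>"
  unfolding \<kappa>_def T_def by (rule real_le_rsqrt) (rule lipc_sq_le[OF A(1) S_ge X_bound])

lemma \<kappa>_nonneg: "0 \<le> \<kappa>"
  unfolding \<kappa>_def lipc2_def by (intro real_sqrt_ge_zero mult_nonneg_nonneg) auto

lemma \<Lambda>_nonneg: "0 \<le> \<Lambda>"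
  unfolding \<Lambda>_def using \<kappa>_nonneg A T_nonneg by (intro mult_nonneg_nonneg add_nonneg_nonneg) auto

lemma residual_bound:
  assumes "\<omega> \<in> space M"
  shows "lipc T (X n m \<omega>) * sqrt T + vnorm (l L) \<xi> \<le> \<kappa> * sqrt T + A"
  using A lipc_le[OF assms] T_nonneg by (intro add_mono mult_right_mono) auto

lemma loss_le:
  assumes p: "(norm p)\<^sup>2 \<le> T" and "\<omega> \<in> space M"
  shows "loss p (X n m \<omega>) \<le> B"
  unfolding sqloss_def B_def
  using residual_le[OF p, of "X n m \<omega>"] residual_bound[OF assms(2), of n m]
  by (intro power_mono vnorm_nonneg) linarith

lemma loss_diff_le:
  assumes p: "(norm p)\<^sup>2 \<le> T" "(norm p')\<^sup>2 \<le> T" and \<omega>: "\<omega> \<in> space M"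
  shows "\<bar>loss p (X n m \<omega>) - loss p' (X n m \<omega>)\<bar> \<le> \<Lambda> * norm (p - p')"
proof -
  have "2 * lipc T (X n m \<omega>) * (lipc T (X n m \<omega>) * sqrt T + vnorm (l L) \<xi>) \<le> \<Lambda>"
    unfolding \<Lambda>_def using residual_bound[OF \<omega>, of n m] lipc_le[OF \<omega>, of n m] lipc_nonneg[OF T_nonneg]
      T_nonneg vnorm_nonneg \<kappa>_nonneg
    by (intro mult_mono) auto
  then have "2 * lipc T (X n m \<omega>) * (lipc T (X n m \<omega>) * sqrt T + vnorm (l L) \<xi>) * norm (p - p') \<le> \<Lambda> * norm (p - p')"
    by (rule mult_right_mono) simp
  with loss_lipschitz[OF p, of "X n m \<omega>"] show ?thesis by linarith
qed

lemma X_coord': "1 \<le> j \<Longrightarrow> j \<le> l 0 \<Longrightarrow> (\<lambda>\<omega>. X n m \<omega> j) \<in> borel_measurable M"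
  by (rule X_coord[OF _ _ X_meas])

lemma loss_X_measurable: "(\<lambda>\<omega>. loss p (X n m \<omega>)) \<in> borel_measurable M"
  by (rule loss_measurable[OF _ X_coord']) auto

lemma integrable_loss: "(norm p)\<^sup>2 \<le> T \<Longrightarrow> integrable M (\<lambda>\<omega>. loss p (X n m \<omega>))"
  by (rule integrable_const_bound[where B = B])
    (use loss_le loss_nonneg loss_X_measurable in auto)

lemma risk_nonneg: "0 \<le> risk p"
  unfolding risk_def by (intro integral_nonneg_AE AE_I2 loss_nonneg)

lemma risk_le: "(norm p)\<^sup>2 \<le> T \<Longrightarrow> risk p \<le> B"
  unfolding risk_def using loss_le by (intro integral_le_const integrable_loss AE_I2) auto

lemma risk_diff_le:
  assumes p: "(norm p)\<^sup>2 \<le> T" "(norm p')\<^sup>2 \<le> T"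
  shows "\<bar>risk p - risk p'\<bar> \<le> \<Lambda> * norm (p - p')"
proof -
  have "\<bar>risk p - risk p'\<bar> = \<bar>expectation (\<lambda>\<omega>. loss p (X 0 0 \<omega>) - loss p' (X 0 0 \<omega>))\<bar>"
    unfolding risk_def using integrable_loss[OF p(1)] integrable_loss[OF p(2)] by simp
  also have "\<dots> \<le> expectation (\<lambda>\<omega>. \<bar>loss p (X 0 0 \<omega>) - loss p' (X 0 0 \<omega>)\<bar>)"
    by (rule integral_abs_bound)
  also have "\<dots> \<le> \<Lambda> * norm (p - p')"
    using integrable_loss[OF p(1)] integrable_loss[OF p(2)] loss_diff_le[OF p]
    by (intro integral_le_const AE_I2) auto
  finally show ?thesis .
qed

lemma risk_eq_nn_integral:
  assumes "(norm p)\<^sup>2 \<le> T"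
  shows "(\<integral>\<^sup>+x. ennreal (loss p x) \<partial>distr M DS (X n m)) = ennreal (risk p)"
proof -
  have m: "(\<lambda>x. ennreal (loss p x)) \<in> borel_measurable DS"
    using loss_measurable[of "\<lambda>_. p" DS "\<lambda>x. x"] X_coord[OF _ _ measurable_ident] by simp
  have "(\<integral>\<^sup>+x. ennreal (loss p x) \<partial>distr M DS (X n m)) = (\<integral>\<^sup>+\<omega>. ennreal (loss p (X 0 0 \<omega>)) \<partial>M)"
    unfolding X_id[of n m] by (rule nn_integral_distr[OF X_meas]) (use m in simp)
  also have "\<dots> = ennreal (risk p)"
    unfolding risk_def by (rule nn_integral_eq_integral[OF integrable_loss[OF assms] AE_I2]) (rule loss_nonneg)
  finally show ?thesis .
qed

lemma risk_measurable: "risk \<in> borel_measurable borel"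
proof -
  have "(\<lambda>z. loss (fst z) (X 0 0 (snd z))) \<in> borel_measurable (borel \<Otimes>\<^sub>M M)"
    by (rule loss_measurable) (auto intro: measurable_compose[OF measurable_snd X_coord'])
  then have "(\<lambda>(p, \<omega>). loss p (X 0 0 \<omega>)) \<in> borel_measurable (borel \<Otimes>\<^sub>M M)"
    by (simp add: split_beta)
  then show ?thesis unfolding risk_def[abs_def] by (rule borel_measurable_lebesgue_integral)
qed

lemma risk_\<Theta>_measurable: "(\<lambda>\<omega>. risk (\<Theta> n \<omega>)) \<in> borel_measurable M"
  by (rule measurable_compose[OF \<Theta>_meas risk_measurable])

abbreviation bl :: "nat \<Rightarrow> 'w \<Rightarrow> real" where
  "bl n \<omega> \<equiv> bloss (Ms n) (\<lambda>m. X n m \<omega>) (\<Theta> n \<omega>)"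

lemma bl_measurable: "bl n \<in> borel_measurable M"
  by (rule bloss_measurable[OF \<Theta>_meas X_coord'])

context
  fixes \<omega> assumes \<omega>: "\<omega> \<in> space M"
begin

text \<open>\<open>sgd_path\<close> applies to each \<omega> separately, with bounds depending on
  the initial value; \<open>S\<close> makes them uniform.\<close>

lemma iterates_bounds:
  "(norm (\<Theta> n \<omega>))\<^sup>2 \<le> T"
  "(\<Sum>k<n. \<gamma> k * bl k \<omega>) \<le> (S + A)\<^sup>2 / 2"
  "(norm (\<Theta> (Suc n) \<omega> - \<Theta> n \<omega>))\<^sup>2 \<le> 2 * (\<gamma> n * bl n \<omega>)"
proof -
  note p = sgd_path[where p = "\<lambda>n. \<Theta> n \<omega>" and x = "\<lambda>n m. X n m \<omega>" and t = \<gamma> and M = Ms,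
      OF Ms_pos A d X_bound[OF \<omega>] \<gamma>_nonneg \<gamma>_small[OF \<omega>] \<Theta>_rec[OF \<omega>]]
  have s: "0 \<le> norm (\<Theta> 0 \<omega>) + 1" by simp
  have "rad A (norm (\<Theta> 0 \<omega>) + 1) \<le> T"
    unfolding rad_def T_def using power_mono[OF S[OF \<omega>] s, of 2] by (intro diff_right_mono mult_left_mono) auto
  with p(1)[of n] show "(norm (\<Theta> n \<omega>))\<^sup>2 \<le> T" by simp
  show "(norm (\<Theta> (Suc n) \<omega> - \<Theta> n \<omega>))\<^sup>2 \<le> 2 * (\<gamma> n * bl n \<omega>)" by (rule p(3))
  have "norm (\<Theta> 0 \<omega> - center) \<le> S + A"
    using norm_triangle_ineq4[of "\<Theta> 0 \<omega>" center] S[OF \<omega>] A norm_center by simp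
  then have "real L * (norm (\<Theta> 0 \<omega> - center))\<^sup>2 \<le> real L * (S + A)\<^sup>2"
    by (intro mult_left_mono power_mono) auto
  then have "lyap (\<Theta> 0 \<omega>) \<le> real L * (S + A)\<^sup>2"
    using lyap_le[of "\<Theta> 0 \<omega>"] by linarith
  then have "lyap (\<Theta> 0 \<omega>) / (2 * real L) \<le> (S + A)\<^sup>2 / 2"
    using L_pos by (simp add: field_simps)
  with p(2)[of n] show "(\<Sum>k<n. \<gamma> k * bl k \<omega>) \<le> (S + A)\<^sup>2 / 2" by simp
qed

lemma bl_le: "bl n \<omega> \<le> B"
proof -
  have "(\<Sum>m=1..Ms n. loss (\<Theta> n \<omega>) (X n m \<omega>)) \<le> real (Ms n) * B"
    using sum_bounded_above[of "{1..Ms n}" "\<lambda>m. loss (\<Theta> n \<omega>) (X n m \<omega>)" B] loss_le[OF iterates_bounds(1) \<omega>] by simp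
  then show ?thesis using Ms_pos[of n] by (simp add: bloss_def field_simps)
qed

lemma summable_bl: "summable (\<lambda>n. \<gamma> n * bl n \<omega>)"
  by (rule summableI_nonneg_bounded[OF _ iterates_bounds(2)]) (simp add: \<gamma>_nonneg bloss_nonneg)

lemma risk_step: "\<bar>risk (\<Theta> (Suc n) \<omega>) - risk (\<Theta> n \<omega>)\<bar> \<le> \<Lambda> * norm (\<Theta> (Suc n) \<omega> - \<Theta> n \<omega>)"
  by (rule risk_diff_le[OF iterates_bounds(1) iterates_bounds(1)])

text \<open>Here the batch loss is bounded crudely by \<open>B\<close>, which makes the increment
  linear in the step size.\<close>

lemma risk_step_le: "\<bar>risk (\<Theta> (Suc n) \<omega>) - risk (\<Theta> n \<omega>)\<bar> \<le> (\<Lambda> * sqrt (4 * lipc2 A S * B)) * \<gamma> n"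
proof -
  have K: "0 \<le> lipc2 A S" by (simp add: lipc2_def)
  have "(norm (bgrad (Ms n) (\<lambda>m. X n m \<omega>) (\<Theta> n \<omega>)))\<^sup>2 \<le> 4 * lipc2 A S * bl n \<omega>"
    by (rule norm_bgrad_le[OF Ms_pos iterates_bounds(1)], unfold T_def) (rule lipc_sq_le[OF A(1) S_ge X_bound[OF \<omega>]])
  also have "\<dots> \<le> 4 * lipc2 A S * B" using K by (intro mult_left_mono bl_le) simp
  finally have "norm (bgrad (Ms n) (\<lambda>m. X n m \<omega>) (\<Theta> n \<omega>)) \<le> sqrt (4 * lipc2 A S * B)"
    by (rule real_le_rsqrt)
  then have "norm (\<Theta> (Suc n) \<omega> - \<Theta> n \<omega>) \<le> \<gamma> n * sqrt (4 * lipc2 A S * B)"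
    using \<gamma>_nonneg[of n] by (simp add: \<Theta>_rec[OF \<omega>] mult_left_mono)
  then have "\<Lambda> * norm (\<Theta> (Suc n) \<omega> - \<Theta> n \<omega>) \<le> \<Lambda> * (\<gamma> n * sqrt (4 * lipc2 A S * B))"
    by (rule mult_left_mono[OF _ \<Lambda>_nonneg])
  with risk_step[of n] show ?thesis by (simp only: mult_ac)
qed

text \<open>Unlike in \<open>risk_step_le\<close>, the batch loss is kept: the squared increment is
  at most a multiple of \<open>\<gamma> n * bl n \<omega>\<close>, which is summable.\<close>

lemma summable_risk_step: "summable (\<lambda>n. (risk (\<Theta> (Suc n) \<omega>) - risk (\<Theta> n \<omega>))\<^sup>2)"
proof (rule summable_comparison_test'[OF summable_mult[OF summable_bl, of "\<Lambda>\<^sup>2 * 2"]])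
  fix n
  have "(risk (\<Theta> (Suc n) \<omega>) - risk (\<Theta> n \<omega>))\<^sup>2 \<le> (\<Lambda> * norm (\<Theta> (Suc n) \<omega> - \<Theta> n \<omega>))\<^sup>2"
    using power_mono[OF risk_step abs_ge_zero, of n 2] by simp
  also have "\<dots> \<le> \<Lambda>\<^sup>2 * (2 * (\<gamma> n * bl n \<omega>))"
    unfolding power_mult_distrib by (intro mult_left_mono iterates_bounds(3)) simp
  finally show "norm ((risk (\<Theta> (Suc n) \<omega>) - risk (\<Theta> n \<omega>))\<^sup>2) \<le> \<Lambda>\<^sup>2 * 2 * (\<gamma> n * bl n \<omega>)"
    by simp
qed

end

text \<open>Freezing at \<open>\<Theta> n\<close>: averaging the loss over the independent sample
  gives the risk of the iterate.\<close>

lemma nn_integral_loss: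
  "(\<integral>\<^sup>+\<omega>. ennreal (loss (\<Theta> n \<omega>) (X n m \<omega>)) \<partial>M) = (\<integral>\<^sup>+\<omega>. ennreal (risk (\<Theta> n \<omega>)) \<partial>M)"
proof -
  have "(\<lambda>z. ennreal (loss (fst z) (snd z))) \<in> borel_measurable (borel \<Otimes>\<^sub>M DS)"
    using loss_measurable[of fst "borel \<Otimes>\<^sub>M DS" snd] X_coord[OF _ _ measurable_snd] by simp
  from nn_integral_distr_pair[OF \<Theta>_meas X_meas \<Theta>_X_distr this]
  have "(\<integral>\<^sup>+\<omega>. ennreal (loss (\<Theta> n \<omega>) (X n m \<omega>)) \<partial>M)
    = (\<integral>\<^sup>+\<omega>. (\<integral>\<^sup>+x. ennreal (loss (\<Theta> n \<omega>) x) \<partial>distr M DS (X n m)) \<partial>M)" by simp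
  also have "\<dots> = (\<integral>\<^sup>+\<omega>. ennreal (risk (\<Theta> n \<omega>)) \<partial>M)"
    by (rule nn_integral_cong) (rule risk_eq_nn_integral[OF iterates_bounds(1)])
  finally show ?thesis .
qed

lemma nn_integral_bl: "(\<integral>\<^sup>+\<omega>. ennreal (bl n \<omega>) \<partial>M) = (\<integral>\<^sup>+\<omega>. ennreal (risk (\<Theta> n \<omega>)) \<partial>M)"
proof -
  let ?R = "\<integral>\<^sup>+\<omega>. ennreal (risk (\<Theta> n \<omega>)) \<partial>M"
  have m: "(\<lambda>\<omega>. ennreal (loss (\<Theta> n \<omega>) (X n m \<omega>))) \<in> borel_measurable M" for m
    using loss_measurable[OF \<Theta>_meas X_coord'] by simp
  have "(\<integral>\<^sup>+\<omega>. ennreal (bl n \<omega>) \<partial>M)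
    = (\<integral>\<^sup>+\<omega>. ennreal (1 / real (Ms n)) * (\<Sum>m=1..Ms n. ennreal (loss (\<Theta> n \<omega>) (X n m \<omega>))) \<partial>M)"
    unfolding bloss_def by (intro nn_integral_cong, subst ennreal_mult) (simp_all add: sum_nonneg loss_nonneg)
  also have "\<dots> = ennreal (1 / real (Ms n)) * (\<Sum>m=1..Ms n. \<integral>\<^sup>+\<omega>. ennreal (loss (\<Theta> n \<omega>) (X n m \<omega>)) \<partial>M)"
    using m by (simp add: nn_integral_cmult nn_integral_sum)
  also have "\<dots> = ennreal (1 / real (Ms n)) * (of_nat (Ms n) * ?R)"
    by (simp add: nn_integral_loss)
  also have "\<dots> = ennreal (1 / real (Ms n) * real (Ms n)) * ?R"
    unfolding ennreal_of_nat_eq_real_of_nat by (subst ennreal_mult) (simp_all add: mult.assoc)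
  also have "\<dots> = ?R" using Ms_pos[of n] by simp
  finally show ?thesis .
qed

text \<open>In expectation the risk may be exchanged for the batch loss, whose weighted sums are
  bounded by one constant along every trajectory.\<close>

lemma AE_summable_risk: "AE \<omega> in M. summable (\<lambda>n. \<gamma> n * risk (\<Theta> n \<omega>))"
proof (rule AE_summable_of_expectation)
  have eq: "(\<integral>\<^sup>+\<omega>. ennreal (\<gamma> n * risk (\<Theta> n \<omega>)) \<partial>M) = (\<integral>\<^sup>+\<omega>. ennreal (\<gamma> n * bl n \<omega>) \<partial>M)" for n
    using risk_\<Theta>_measurable[of n] bl_measurable[of n] nn_integral_bl[of n]
    by (simp add: ennreal_mult \<gamma>_nonneg risk_nonneg bloss_nonneg nn_integral_cmult)
  have "(\<Sum>n. \<integral>\<^sup>+\<omega>. ennreal (\<gamma> n * risk (\<Theta> n \<omega>)) \<partial>M) = (\<integral>\<^sup>+\<omega>. (\<Sum>n. ennreal (\<gamma> n * bl n \<omega>)) \<partial>M)"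
    unfolding eq by (rule nn_integral_suminf[symmetric]) (use bl_measurable in simp)
  also have "\<dots> \<le> (\<integral>\<^sup>+\<omega>. ennreal ((S + A)\<^sup>2 / 2) \<partial>M)"
  proof (rule nn_integral_mono)
    fix \<omega> assume \<omega>: "\<omega> \<in> space M"
    have "(\<Sum>n. ennreal (\<gamma> n * bl n \<omega>)) = ennreal (\<Sum>n. \<gamma> n * bl n \<omega>)"
      by (rule suminf_ennreal2[OF _ summable_bl[OF \<omega>]]) (simp add: \<gamma>_nonneg bloss_nonneg)
    also have "\<dots> \<le> ennreal ((S + A)\<^sup>2 / 2)"
      by (rule ennreal_leI[OF suminf_le_const[OF summable_bl[OF \<omega>] iterates_bounds(2)[OF \<omega>]]])
    finally show "(\<Sum>n. ennreal (\<gamma> n * bl n \<omega>)) \<le> ennreal ((S + A)\<^sup>2 / 2)" .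
  qed
  also have "\<dots> < \<infinity>" by (simp add: emeasure_space_1)
  finally show "(\<Sum>n. \<integral>\<^sup>+\<omega>. ennreal (\<gamma> n * risk (\<Theta> n \<omega>)) \<partial>M) < \<infinity>" .
qed (use risk_\<Theta>_measurable \<gamma>_nonneg risk_nonneg in auto)

lemma AE_risk_tendsto_0: "AE \<omega> in M. (\<lambda>n. risk (\<Theta> n \<omega>)) \<longlonglongrightarrow> 0"
  using AE_summable_risk AE_space
proof eventually_elim
  case (elim \<omega>)
  show ?case
    by (rule tendsto_0_of_summable_steps[OF risk_nonneg \<gamma>_nonneg elim(1) \<gamma>_div
          risk_step_le[OF elim(2)] summable_risk_step[OF elim(2)]])
qed

lemma expectation_risk_tendsto_0: "(\<lambda>n. expectation (\<lambda>\<omega>. risk (\<Theta> n \<omega>))) \<longlonglongrightarrow> 0"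
proof -
  have "(\<lambda>n. expectation (\<lambda>\<omega>. risk (\<Theta> n \<omega>))) \<longlonglongrightarrow> expectation (\<lambda>\<omega>. 0)"
  proof (rule integral_dominated_convergence[where w = "\<lambda>_. B"])
    show "AE \<omega> in M. norm (risk (\<Theta> n \<omega>)) \<le> B" for n
      using risk_nonneg risk_le[OF iterates_bounds(1)] by (intro AE_I2) simp
  qed (use risk_\<Theta>_measurable AE_risk_tendsto_0 in auto)
  then show ?thesis by simp
qed

end

section \<open>Instantiation for the given process\<close>

theorem theorem1p1:
  fixes L :: nat and l :: "nat \<Rightarrow> nat" and a b :: real and \<xi> :: "nat \<Rightarrow> real"
    and e :: "nat \<Rightarrow> 'd::finite"
    and Rf :: "real \<Rightarrow> real \<Rightarrow> real"
    and M :: "'w measure"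
    and X :: "nat \<Rightarrow> nat \<Rightarrow> 'w \<Rightarrow> (nat \<Rightarrow> real)"
    and Ms :: "nat \<Rightarrow> nat"
    and G :: "nat \<Rightarrow> real^'d \<Rightarrow> 'w \<Rightarrow> real^'d"
    and \<Theta> :: "nat \<Rightarrow> 'w \<Rightarrow> real^'d"
    and \<gamma> :: "nat \<Rightarrow> real"
    and emp_risk :: "real \<Rightarrow> nat \<Rightarrow> real^'d \<Rightarrow> 'w \<Rightarrow> real"
    and risk :: "real^'d \<Rightarrow> real"
  assumes L_pos: "L \<ge> 1"
    and l_pos: "\<forall>k. l k \<ge> 1"
    and ab: "a < b"
    and dim: "CARD('d) = (\<Sum>k=1..L. l k * (l (k-1) + 1))"
    and enum: "bij_betw e {1..CARD('d)} (UNIV :: 'd set)"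
    and R_C1: "\<forall>r\<ge>1. \<exists>R'. continuous_on UNIV R' \<and> (\<forall>x. (Rf r has_real_derivative R' x) (at x))"
    and R_zero: "\<forall>r\<ge>1. \<forall>x. x \<le> 1 / (2 * r) \<longrightarrow> Rf r x = 0"
    and R_bounds: "\<forall>r\<ge>1. \<forall>y. 0 \<le> Rf r y \<and> Rf r y \<le> max y 0"
    and R_id: "\<forall>r\<ge>1. \<forall>z. z \<ge> 1 / r \<longrightarrow> Rf r z = z"
    and R_deriv_bdd: "\<exists>B. \<forall>r\<ge>1. \<forall>x. \<bar>deriv (Rf r) x\<bar> \<le> B"
    and P: "prob_space M"
    and X_meas: "\<forall>n m. X n m \<in> measurable M (PiM {1..l 0} (\<lambda>_. borel))"
    and X_range: "\<forall>n m. \<forall>\<omega>\<in>space M. X n m \<omega> \<in> PiE {1..l 0} (\<lambda>_. {a..b})"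
    and X_indep: "prob_space.indep_vars M (\<lambda>_. PiM {1..l 0} (\<lambda>_. borel)) (\<lambda>(n, m). X n m) UNIV"
    and X_id: "\<forall>n m. distr M (PiM {1..l 0} (\<lambda>_. borel)) (X n m)
                     = distr M (PiM {1..l 0} (\<lambda>_. borel)) (X 0 0)"
    and Ms_pos: "\<forall>n. Ms n \<ge> 1"
    and emp_risk_def: "\<forall>r n p \<omega>. emp_risk r n p \<omega> =
        (1 / real (Ms n)) * (\<Sum>m=1..Ms n.
          (vnorm (l L) (\<lambda>i. realiz l (\<lambda>k. Rf (r powr (1 / real k))) (\<lambda>j. p $ e j) L (X n m \<omega>) i
                          - \<xi> i))^2)"
    and risk_def: "\<forall>p. risk p = prob_space.expectation M (\<lambda>\<omega>.
          (vnorm (l L) (\<lambda>i. realiz l (\<lambda>k y. max y 0) (\<lambda>j. p $ e j) L (X 0 0 \<omega>) i - \<xi> i))^2)"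
    and G_lim: "\<forall>n p. \<forall>\<omega>\<in>space M.
        (\<exists>g. ((\<lambda>r. grad (\<lambda>p'. emp_risk r n p' \<omega>) p) \<longlongrightarrow> g) at_top) \<longrightarrow>
        ((\<lambda>r. grad (\<lambda>p'. emp_risk r n p' \<omega>) p) \<longlongrightarrow> G n p \<omega>) at_top"
    and \<Theta>_meas: "\<forall>n. \<Theta> n \<in> borel_measurable M"
    and \<Theta>_indep: "prob_space.indep_set M
        {\<Theta> 0 -` A \<inter> space M | A. A \<in> sets (borel :: (real^'d) measure)}
        {(\<lambda>\<omega> (n, m). X n m \<omega>) -` B \<inter> space M | B.
           B \<in> sets (PiM (UNIV :: (nat \<times> nat) set) (\<lambda>_. PiM {1..l 0} (\<lambda>_. borel)))}"
    and \<gamma>_nonneg: "\<forall>n. \<gamma> n \<ge> 0"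
    and \<Theta>_rec: "\<forall>n. \<forall>\<omega>\<in>space M. \<Theta> (Suc n) \<omega> = \<Theta> n \<omega> - \<gamma> n *\<^sub>R G n (\<Theta> n \<omega>) \<omega>"
    and \<gamma>_small: "\<forall>n. \<forall>\<omega>\<in>space M.
        (4 * real L * real CARD('d) * max (max \<bar>a\<bar> \<bar>b\<bar>) (max (vnorm (l L) \<xi>) 1)) ^ (2 * L) * \<gamma> n
          \<le> 1 / (norm (\<Theta> 0 \<omega>) + 1) ^ (2 * L)"
    and \<gamma>_div: "filterlim (\<lambda>n. \<Sum>k<n. \<gamma> k) at_top sequentially"
  shows "(\<exists>C::real. prob_space.prob M {\<omega> \<in> space M. \<forall>n. norm (\<Theta> n \<omega>) \<le> C} = 1)
    \<and> prob_space.prob M {\<omega> \<in> space M. limsup (\<lambda>n. ereal (risk (\<Theta> n \<omega>))) = 0} = 1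
    \<and> limsup (\<lambda>n. ereal (prob_space.expectation M (\<lambda>\<omega>. risk (\<Theta> n \<omega>)))) = 0"
proof -
  interpret prob_space M by fact
  have dim': "CARD('d) = offs l (Suc L)"
    using dim by (simp only: offs_eq_card)
  interpret smooth_network l L \<xi> e Rf
    by unfold_locales (fact L_pos enum[unfolded dim'] R_C1 R_zero R_bounds R_id)+
  define A where "A = max (max \<bar>a\<bar> \<bar>b\<bar>) (max (vnorm (l L) \<xi>) 1)"
  have A: "1 \<le> A" "vnorm (l L) \<xi> \<le> A" "\<bar>a\<bar> \<le> A" "\<bar>b\<bar> \<le> A"
    by (auto simp: A_def)
  have d: "l 0 + 1 \<le> offs l (Suc L)"
  proof -
    have "1 * (l 0 + 1) \<le> l 1 * (l 0 + 1)" using l_pos by (intro mult_right_mono) auto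
    also have "\<dots> = offs l (Suc 1)" by (simp add: offs_def)
    also have "\<dots> \<le> offs l (Suc L)" using L_pos by (intro offs_mono) simp
    finally show ?thesis by simp
  qed
  have X_bound: "1 + (vnorm (l 0) (X n m \<omega>))\<^sup>2 \<le> real (offs l (Suc L)) * A\<^sup>2" if "\<omega> \<in> space M" for n m \<omega>
  proof -
    have "(X n m \<omega> j)\<^sup>2 \<le> A\<^sup>2" if "j \<in> {1..l 0}" for j
    proof -
      have "X n m \<omega> j \<in> {a..b}" using X_range \<open>\<omega> \<in> space M\<close> that by (auto simp: PiE_iff)
      then have "\<bar>X n m \<omega> j\<bar> \<le> A" using A by auto
      then show ?thesis using abs_le_square_iff[of "X n m \<omega> j" A] A(1) by simp
    qed
    then have "(vnorm (l 0) (X n m \<omega>))\<^sup>2 \<le> real (l 0) * A\<^sup>2"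
      unfolding vnorm_sq using sum_bounded_above[of "{1..l 0}" "\<lambda>j. (X n m \<omega> j)\<^sup>2" "A\<^sup>2"] by simp
    moreover have "1 \<le> A\<^sup>2" using A(1) by simp
    ultimately have "1 + (vnorm (l 0) (X n m \<omega>))\<^sup>2 \<le> real (l 0 + 1) * A\<^sup>2"
      by (simp add: distrib_right)
    also have "\<dots> \<le> real (offs l (Suc L)) * A\<^sup>2"
      using d by (intro mult_right_mono) auto
    finally show ?thesis .
  qed
  \<comment> \<open>The smoothed gradients converge at every parameter and every sample point, so
    \<open>G_lim\<close> determines \<open>G\<close> on all of \<open>space M\<close>.\<close>
  have G_eq: "G n p \<omega> = bgrad (Ms n) (\<lambda>m. X n m \<omega>) p" if "\<omega> \<in> space M" for n p \<omega>
  proof -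
    have emp: "emp_risk r n p' \<omega> = (1 / real (Ms n)) * (\<Sum>m=1..Ms n. sqloss l L \<xi> (act r) (params p') (X n m \<omega>))"
      for r p'
      unfolding emp_risk_def[rule_format] sqloss_def act_def ..
    have "((\<lambda>r. grad (\<lambda>p'. emp_risk r n p' \<omega>) p) \<longlongrightarrow> bgrad (Ms n) (\<lambda>m. X n m \<omega>) p) at_top"
      unfolding emp by (rule grad_batch_tendsto)
    moreover from this have "((\<lambda>r. grad (\<lambda>p'. emp_risk r n p' \<omega>) p) \<longlongrightarrow> G n p \<omega>) at_top"
      using G_lim that by blast
    ultimately show ?thesis
      using tendsto_unique[OF trivial_limit_at_top_linorder] by blast
  qed
  have not_summable: "\<not> summable \<gamma>"
  proof
    assume "summable \<gamma>"
    then have "(\<lambda>n. \<Sum>k<n. \<gamma> k) \<longlonglongrightarrow> suminf \<gamma>" by (rule summable_LIMSEQ)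
    with filterlim_at_top_imp_at_infinity[OF \<gamma>_div] show False
      using not_tendsto_and_filterlim_at_infinity[OF sequentially_bot] by blast
  qed
  \<comment> \<open>A single nonzero step size already forces a bound on the initial value that is
    uniform in \<omega>, because the step size restriction holds pointwise.\<close>
  then obtain N where "\<gamma> N \<noteq> 0"
    using summable_zero by (metis ext)
  then have N: "0 < \<gamma> N" using \<gamma>_nonneg by (simp add: less_le)
  have S: "norm (\<Theta> 0 \<omega>) + 1 \<le> 1 / \<gamma> N" if \<omega>: "\<omega> \<in> space M" for \<omega>
  proof -
    let ?s = "norm (\<Theta> 0 \<omega>) + 1" and ?c = "4 * real L * real (offs l (Suc L)) * A"
    have "1 * 1 * 1 * 1 \<le> ?c" using L_pos d A(1) by (intro mult_mono) auto
    then have "1 \<le> ?c ^ (2 * L)" by (intro one_le_power) simp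
    then have "1 * \<gamma> N \<le> ?c ^ (2 * L) * \<gamma> N" using N by (intro mult_right_mono) auto
    also have "\<dots> \<le> 1 / ?s ^ (2 * L)"
      using \<gamma>_small[rule_format, OF \<omega>, of N] unfolding dim' A_def .
    \<comment> \<open>Both \<open>?s\<close> and the exponent \<open>2 * L\<close> are at least 1,
      so the power dominates \<open>?s\<close>.\<close>
    also have "\<dots> \<le> 1 / ?s"
      using self_le_power[of ?s "2 * L"] L_pos
      by (intro divide_left_mono mult_pos_pos zero_less_power) (auto intro: add_nonneg_pos)
    finally have "\<gamma> N * ?s \<le> 1" by (simp add: pos_le_divide_eq add_nonneg_pos)
    then show ?thesis using N by (simp add: pos_le_divide_eq mult.commute)
  qed
  interpret S: sgd l L \<xi> e M X Ms \<Theta> \<gamma> A "1 / \<gamma> N"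
  proof unfold_locales
    show "1 \<le> offs l (Suc L)" using d by simp
    show "\<Theta> (Suc n) \<omega> = \<Theta> n \<omega> - \<gamma> n *\<^sub>R bgrad (Ms n) (\<lambda>m. X n m \<omega>) (\<Theta> n \<omega>)" if "\<omega> \<in> space M" for n \<omega>
      using \<Theta>_rec G_eq[OF that] that by simp
    show "(4 * real L * real (offs l (Suc L)) * A) ^ (2 * L) * \<gamma> n \<le> 1 / (norm (\<Theta> 0 \<omega>) + 1) ^ (2 * L)"
      if "\<omega> \<in> space M" for n \<omega>
      using \<gamma>_small[rule_format, OF that, of n] unfolding dim' A_def .
  qed (fact A X_meas[rule_format] X_bound X_indep X_id[rule_format] Ms_pos[rule_format]
      \<Theta>_meas[rule_format] \<Theta>_indep \<gamma>_nonneg[rule_format] not_summable S)+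
  have risk: "risk = S.risk"
    by (rule ext) (simp add: risk_def S.risk_def sqloss_def relu_fold)
  have "norm (\<Theta> n \<omega>) \<le> sqrt S.T" if "\<omega> \<in> space M" for n \<omega>
    by (rule real_le_rsqrt[OF S.iterates_bounds(1)[OF that]])
  then have "{\<omega> \<in> space M. \<forall>n. norm (\<Theta> n \<omega>) \<le> sqrt S.T} = space M" by blast
  then have "prob {\<omega> \<in> space M. \<forall>n. norm (\<Theta> n \<omega>) \<le> sqrt S.T} = 1" by (simp add: prob_space)
  moreover have "prob {\<omega> \<in> space M. limsup (\<lambda>n. ereal (risk (\<Theta> n \<omega>))) = 0} = 1"
  proof -
    have [measurable]: "(\<lambda>\<omega>. risk (\<Theta> n \<omega>)) \<in> borel_measurable M" for n
      unfolding risk by (rule S.risk_\<Theta>_measurable)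
    have "AE \<omega> in M. limsup (\<lambda>n. ereal (risk (\<Theta> n \<omega>))) = 0"
      using S.AE_risk_tendsto_0 unfolding risk
    proof eventually_elim
      case (elim \<omega>)
      from lim_imp_Limsup[OF sequentially_bot tendsto_ereal[OF elim]] show ?case
        by (simp add: zero_ereal_def)
    qed
    moreover have "{\<omega> \<in> space M. limsup (\<lambda>n. ereal (risk (\<Theta> n \<omega>))) = 0} \<in> events"
      by measurable
    ultimately show ?thesis by (simp add: prob_Collect_eq_1)
  qed
  moreover have "limsup (\<lambda>n. ereal (expectation (\<lambda>\<omega>. risk (\<Theta> n \<omega>)))) = 0"
    using lim_imp_Limsup[OF sequentially_bot tendsto_ereal[OF S.expectation_risk_tendsto_0]]
    by (simp add: risk zero_ereal_def)
  ultimately show ?thesis by blast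
qed

end
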